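(* Let $N\ge 2$, let $\alpha:F_N\to\pi_1(\Gamma)$ be a marking on $F_N$, let $X=\widetilde\Gamma$ be the universal cover of $\Gamma$, and let $r\ge 2$ be an arbitrary integer. Let $\vartheta:\mathcal B_{\Gamma,r}\to\mathbb Z_{\ge 0}$ be a function such that: (1) For every $K\in\mathcal B_{\Gamma,r}$ and every $g\in F_N$ we have $\vartheta(gK)=\vartheta(K)$. (2) For every $J\in\mathcal B'_{\Gamma,r}$ with geometric partition $\{e_1,\dots,e_n\}\sqcup\{f_1,\dots,f_m\}$ of the set of terminal edges of $J$ we have $$\sum_{(U_1,\dots,U_n)}\vartheta(J\cup U_1\cup\dots\cup U_n)=\sum_{(V_1,\dots,V_m)}\vartheta(J\cup V_1\cup\dots\cup V_m),$$ where the first sum is over all $(U_1,\dots,U_n)$ with $U_i\in P_+(q(e_i))$ for all $i$, and the second sum is over all $(V_1,\dots,V_m)$ with $V_j\in P_+(q(f_j))$ for all $j$. (3) There exists $K\in\mathcal B_{\Gamma,r}$ such that $\vartheta(K)>0$. Then there exists a finite folded (possibly disconnected) cyclically reduced $\Gamma$-graph $\Delta$ such that for every $K\in\mathcal B_{\Gamma,r}$ we have $$\vartheta(K)=\langle K,\Delta\rangle_\Gamma.$$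
   Context: $F_N$ is the free group of rank $N$. Graphs have oriented edges: each oriented edge $e$ has an initial vertex $o(e)$, a terminal vertex $t(e)$, and an inverse oriented edge $e^{-1}\neq e$. The set of oriented edges of a graph $Y$ is $EY$. The degree of a vertex is the number of oriented edges originating at it. Graph morphisms send vertices to vertices and oriented edges to oriented edges, compatibly with $o$, $t$ and inversion. A marking on $F_N$ is an isomorphism $\alpha:F_N\to\pi_1(\Gamma)$, where $\Gamma$ is a finite connected graph without degree-one vertices and with first Betti number $N$. The universal cover $X=\widetilde\Gamma$ is a tree with the simplicial metric $d$ (each edge of length $1$), on which $F_N$ acts by covering transformations via $\alpha$. A finite subtree of $X$ is non-degenerate if it contains at least one edge. A terminal vertex of a finite subtree $K$ is a degree-one vertex of $K$. A terminal edge of $K$ is an oriented edge $e$ of $K$ such that $t(e)$ is a terminal vertex of $K$. For an oriented edge $e$ of $X$, $q(e)$ is the set of all oriented edges $e'$ of $X$ such that $ee'$ is a reduced edge-path (i.e. $o(e')=t(e)$ and $e'\ne e^{-1}$). For a set $B$, $P_+(B)$ is the set of all nonempty subsets of $B$. For $U\subseteq q(e)$, $K\cup U$ denotes the subgraph obtained by adding to $K$ the edges in $U$ together with their endpoints. $\mathcal B_{\Gamma,r}$ is the set of all finite non-degenerate subtrees $K$ of $X$ such that for some vertex $p$ of $K$ the distance from $p$ to every terminal vertex of $K$ equals $r$. $\mathcal B'_{\Gamma,r}$ is the set of all finite non-degenerate subtrees $J$ of $X$ such that for some edge $e$ of $J$ with midpoint $p$, the distance from $p$ to every terminal vertex of $J$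 equals $r-\frac12$. For such $J$, $e$, $p$, let $J_0$ and $J_1$ be the connected components of $J-\{p\}$ containing $o(e)$ and $t(e)$ respectively. Let $e_1,\dots,e_n$ be all the terminal edges of $J$ contained in $J_0$ and $f_1,\dots,f_m$ all the terminal edges of $J$ contained in $J_1$. Then $\{e_1,\dots,e_n\}\sqcup\{f_1,\dots,f_m\}$ is called the geometric partition of the set of terminal edges of $J$. (All trees $J\cup U_1\cup\dots\cup U_n$ and $J\cup V_1\cup\dots\cup V_m$ in condition (2) belong to $\mathcal B_{\Gamma,r}$.) A $\Gamma$-graph is a graph $\Delta$ together with a graph morphism $\tau:\Delta\to\Gamma$; $\tau(e)$ is the label of an edge $e$. Subtrees of $X$ are $\Gamma$-graphs via the covering map $X\to\Gamma$. A $\Gamma$-morphism is a graph morphism $f:\Delta_1\to\Delta_2$ of $\Gamma$-graphs with $\tau_1=\tau_2\circ f$. A $\Gamma$-graph is folded if $\tau$ is locally injective, i.e. for every vertex $x$ and every $e\in E\Gamma$ there is at most one edge with origin $x$ and label $e$. In a folded $\Gamma$-graph $\Delta$, the link $Lk_\Delta(x)\subseteq E\Gamma$ of a vertex $x$ is the set of labels of the edges with origin $x$. A nonempty finite $\Gamma$-graph is cyclically reduced if it is folded and every vertex has degree at least $2$. For a finite non-degenerate subtree $K\subseteq X$ and a finite cyclically reduced $\Gamma$-graph $\Delta$, an occurrence of $K$ in $\Delta$ is a $\Gamma$-morphism $\mathfrak O:K\to\Delta$ such that $Lk_K(x)=Lk_\Delta(\mathfrak O(x))$ for every vertex $x$ of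 $K$ of degree at least $2$ in $K$. The number of occurrences of $K$ in $\Delta$ is denoted $\langle K,\Delta\rangle_\Gamma$. *)

theory Defs
  imports Complex_Main "HOL-Algebra.Group" "HOL-Library.Function_Algebras"
begin

section \<open>Graphs\<close>

record ('v, 'e) graph =
  verts :: "'v set"
  edges :: "'e set"
  org :: "'e \<Rightarrow> 'v"
  ter :: "'e \<Rightarrow> 'v"
  einv :: "'e \<Rightarrow> 'e"

definition is_graph :: "('v, 'e) graph \<Rightarrow> bool" where
  "is_graph G \<longleftrightarrow> (\<forall>e\<in>edges G.
     org G e \<in> verts G \<and> ter G e \<in> verts G \<and>
     einv G e \<in> edges G \<and> einv G e \<noteq> e \<and> einv G (einv G e) = e \<and>
     org G (einv G e) = ter G e \<and> ter G (einv G e) = org G e)"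

definition finite_graph :: "('v, 'e) graph \<Rightarrow> bool" where
  "finite_graph G \<longleftrightarrow> is_graph G \<and> finite (verts G) \<and> finite (edges G)"

definition out_edges :: "('v, 'e) graph \<Rightarrow> 'v \<Rightarrow> 'e set" where
  "out_edges G v = {e \<in> edges G. org G e = v}"

definition degree :: "('v, 'e) graph \<Rightarrow> 'v \<Rightarrow> nat" where
  "degree G v = card (out_edges G v)"

fun walk :: "('v, 'e) graph \<Rightarrow> 'v \<Rightarrow> 'e list \<Rightarrow> 'v \<Rightarrow> bool" where
  "walk G u [] v \<longleftrightarrow> u = v \<and> u \<in> verts G"
| "walk G u (e # p) v \<longleftrightarrow> e \<in> edges G \<and> org G e = u \<and> walk G (ter G e) p v"

definition connected_graph :: "('v, 'e) graph \<Rightarrow> bool" where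
  "connected_graph G \<longleftrightarrow> is_graph G \<and> verts G \<noteq> {} \<and>
     (\<forall>u\<in>verts G. \<forall>v\<in>verts G. \<exists>p. walk G u p v)"

text \<open>Reducedness and free reduction of a word with respect to an inversion \<open>\<iota>\<close> of its letters;
  used both for edge-paths in graphs and for words in a free group.\<close>

definition reduced :: "('a \<Rightarrow> 'a) \<Rightarrow> 'a list \<Rightarrow> bool" where
  "reduced \<iota> = successively (\<lambda>a b. b \<noteq> \<iota> a)"

definition red_cons :: "('a \<Rightarrow> 'a) \<Rightarrow> 'a \<Rightarrow> 'a list \<Rightarrow> 'a list" where
  "red_cons \<iota> a w = (case w of [] \<Rightarrow> [a] | b # w' \<Rightarrow> if b = \<iota> a then w' else a # w)"

definition reduce :: "('a \<Rightarrow> 'a) \<Rightarrow> 'a list \<Rightarrow> 'a list" where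
  "reduce \<iota> w = foldr (red_cons \<iota>) w []"

definition is_tree :: "('v, 'e) graph \<Rightarrow> bool" where
  "is_tree G \<longleftrightarrow> connected_graph G \<and>
     (\<forall>v p. walk G v p v \<and> reduced (einv G) p \<longrightarrow> p = [])"

definition gdist :: "('v, 'e) graph \<Rightarrow> 'v \<Rightarrow> 'v \<Rightarrow> nat" where
  "gdist G u v = (LEAST n. \<exists>p. walk G u p v \<and> length p = n)"

text \<open>A subgraph carries the same structure functions as the ambient graph, so that it is
  determined by its sets of vertices and oriented edges.\<close>

definition subgraph :: "('v, 'e) graph \<Rightarrow> ('v, 'e) graph \<Rightarrow> bool" where
  "subgraph H G \<longleftrightarrow> is_graph H \<and> verts H \<subseteq> verts G \<and> edges H \<subseteq> edges G \<and>
     org H = org G \<and> ter H = ter G \<and> einv H = einv G"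

definition delete_edge :: "('v, 'e) graph \<Rightarrow> 'e \<Rightarrow> ('v, 'e) graph" where
  "delete_edge G e = G\<lparr>edges := edges G - {e, einv G e}\<rparr>"

definition component :: "('v, 'e) graph \<Rightarrow> 'v \<Rightarrow> ('v, 'e) graph" where
  "component G v = G\<lparr>verts := {u. \<exists>p. walk G v p u},
                     edges := {e \<in> edges G. \<exists>p. walk G v p (org G e)}\<rparr>"

text \<open>Real simplicial 1-chains are functions \<open>c\<close> on oriented edges with \<open>c (e\<^sup>-\<^sup>1) = - c e\<close>;
  the cycles among them form the first homology, as a graph has no 2-cells.\<close>

definition cycle_space :: "('v, 'e) graph \<Rightarrow> ('e \<Rightarrow> real) set" where
  "cycle_space G = {c. (\<forall>e. e \<notin> edges G \<longrightarrow> c e = 0) \<and>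
     (\<forall>e\<in>edges G. c (einv G e) = - c e) \<and>
     (\<forall>v\<in>verts G. (\<Sum>e\<in>out_edges G v. c e) = 0)}"

definition betti :: "('v, 'e) graph \<Rightarrow> nat" where
  "betti G = vector_space.dim (\<lambda>(a::real) c e. a * c e) (cycle_space G)"


section \<open>Free groups, fundamental groups and markings\<close>

text \<open>The letter \<open>(i, True)\<close> is the \<open>i\<close>-th free generator and \<open>(i, False)\<close> its inverse.\<close>

definition letter_inv :: "nat \<times> bool \<Rightarrow> nat \<times> bool" where
  "letter_inv = (\<lambda>(i, b). (i, \<not> b))"

definition free_group :: "nat \<Rightarrow> (nat \<times> bool) list monoid" where
  "free_group N = \<lparr>carrier = {w. set w \<subseteq> {..<N} \<times> UNIV \<and> reduced letter_inv w},
                   mult = (\<lambda>u w. reduce letter_inv (u @ w)),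
                   one = []\<rparr>"

definition pi1 :: "('v, 'e) graph \<Rightarrow> 'v \<Rightarrow> 'e list monoid" where
  "pi1 \<Gamma> v0 = \<lparr>carrier = {p. walk \<Gamma> v0 p v0 \<and> reduced (einv \<Gamma>) p},
               mult = (\<lambda>p q. reduce (einv \<Gamma>) (p @ q)),
               one = []\<rparr>"

definition marking ::
  "nat \<Rightarrow> ('v, 'e) graph \<Rightarrow> 'v \<Rightarrow> ((nat \<times> bool) list \<Rightarrow> 'e list) \<Rightarrow> bool" where
  "marking N \<Gamma> v0 \<alpha> \<longleftrightarrow>
     finite_graph \<Gamma> \<and> connected_graph \<Gamma> \<and> (\<forall>v\<in>verts \<Gamma>. degree \<Gamma> v \<noteq> 1) \<and> betti \<Gamma> = N \<and>
     v0 \<in> verts \<Gamma> \<and> \<alpha> \<in> iso (free_group N) (pi1 \<Gamma> v0)"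


section \<open>The universal cover\<close>

definition endpoint :: "('v, 'e) graph \<Rightarrow> 'v \<Rightarrow> 'e list \<Rightarrow> 'v" where
  "endpoint \<Gamma> v0 p = (if p = [] then v0 else ter \<Gamma> (last p))"

text \<open>The vertices of the universal cover are the reduced edge-paths \<open>p\<close> of \<open>\<Gamma>\<close> starting at the
  base vertex; the oriented edge \<open>(p, e)\<close> is the lift of \<open>e\<close> with initial vertex \<open>p\<close>.\<close>

definition univ_cover :: "('v, 'e) graph \<Rightarrow> 'v \<Rightarrow> ('e list, 'e list \<times> 'e) graph" where
  "univ_cover \<Gamma> v0 =
     \<lparr>verts = {p. reduced (einv \<Gamma>) p \<and> (\<exists>v. walk \<Gamma> v0 p v)},
      edges = {(p, e). reduced (einv \<Gamma>) p \<and> e \<in> edges \<Gamma> \<and> walk \<Gamma> v0 p (org \<Gamma> e)},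
      org = fst,
      ter = (\<lambda>(p, e). reduce (einv \<Gamma>) (p @ [e])),
      einv = (\<lambda>(p, e). (reduce (einv \<Gamma>) (p @ [e]), einv \<Gamma> e))\<rparr>"

text \<open>Morphisms of graphs are pairs of a vertex map and an edge map.\<close>

definition covering :: "('v, 'e) graph \<Rightarrow> 'v \<Rightarrow> ('e list \<Rightarrow> 'v) \<times> ('e list \<times> 'e \<Rightarrow> 'e)" where
  "covering \<Gamma> v0 = (endpoint \<Gamma> v0, snd)"

text \<open>The subgraph \<open>gK\<close>, where \<open>h = \<alpha> g\<close> acts on the universal cover by \<open>p \<mapsto> h p\<close>.\<close>

definition translate ::
  "('v, 'e) graph \<Rightarrow> 'e list \<Rightarrow> ('e list, 'e list \<times> 'e) graph \<Rightarrow> ('e list, 'e list \<times> 'e) graph" where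
  "translate \<Gamma> h K =
     K\<lparr>verts := (\<lambda>p. reduce (einv \<Gamma>) (h @ p)) ` verts K,
       edges := (\<lambda>(p, e). (reduce (einv \<Gamma>) (h @ p), e)) ` edges K\<rparr>"


section \<open>Finite subtrees\<close>

definition nondeg_finite_subtree :: "('v, 'e) graph \<Rightarrow> ('v, 'e) graph \<Rightarrow> bool" where
  "nondeg_finite_subtree X K \<longleftrightarrow>
     subgraph K X \<and> finite_graph K \<and> is_tree K \<and> edges K \<noteq> {}"

definition terminal_verts :: "('v, 'e) graph \<Rightarrow> 'v set" where
  "terminal_verts K = {v \<in> verts K. degree K v = 1}"

definition terminal_edges :: "('v, 'e) graph \<Rightarrow> 'e set" where
  "terminal_edges K = {e \<in> edges K. ter K e \<in> terminal_verts K}"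

definition next_edges :: "('v, 'e) graph \<Rightarrow> 'e \<Rightarrow> 'e set" where
  "next_edges X e = {e' \<in> edges X. org X e' = ter X e \<and> e' \<noteq> einv X e}"

definition P_plus :: "'a set \<Rightarrow> 'a set set" where
  "P_plus B = Pow B - {{}}"

definition add_edges :: "('v, 'e) graph \<Rightarrow> 'e set \<Rightarrow> ('v, 'e) graph" where
  "add_edges K U = K\<lparr>verts := verts K \<union> org K ` U \<union> ter K ` U,
                     edges := edges K \<union> U \<union> einv K ` U\<rparr>"

definition \<B> :: "('v, 'e) graph \<Rightarrow> nat \<Rightarrow> ('v, 'e) graph set" where
  "\<B> X r = {K. nondeg_finite_subtree X K \<and>
     (\<exists>p\<in>verts K. \<forall>v\<in>terminal_verts K. gdist X p v = r)}"

text \<open>A path from the midpoint of \<open>e\<close> to a vertex first traverses one of the two halves of \<open>e\<close>.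
  The central edge of a tree is unique up to inversion.\<close>

definition midpoint_dist :: "('v, 'e) graph \<Rightarrow> 'e \<Rightarrow> 'v \<Rightarrow> real" where
  "midpoint_dist X e v = 1/2 + real (min (gdist X (org X e) v) (gdist X (ter X e) v))"

definition central_edge :: "('v, 'e) graph \<Rightarrow> nat \<Rightarrow> ('v, 'e) graph \<Rightarrow> 'e \<Rightarrow> bool" where
  "central_edge X r J e \<longleftrightarrow> e \<in> edges J \<and>
     (\<forall>v\<in>terminal_verts J. midpoint_dist X e v = real r - 1/2)"

definition \<B>' :: "('v, 'e) graph \<Rightarrow> nat \<Rightarrow> ('v, 'e) graph set" where
  "\<B>' X r = {J. nondeg_finite_subtree X J \<and> (\<exists>e. central_edge X r J e)}"

text \<open>The two blocks of the geometric partition. Removing the midpoint of \<open>e\<close> leaves the same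
  whole edges in each component as removing \<open>e\<close> itself.\<close>

definition geom_part0 :: "('v, 'e) graph \<Rightarrow> 'e \<Rightarrow> 'e set" where
  "geom_part0 J e = terminal_edges J \<inter> edges (component (delete_edge J e) (org J e))"

definition geom_part1 :: "('v, 'e) graph \<Rightarrow> 'e \<Rightarrow> 'e set" where
  "geom_part1 J e = terminal_edges J \<inter> edges (component (delete_edge J e) (ter J e))"

text \<open>The sum of \<open>\<theta> (J \<union> U\<^sub>1 \<union> \<dots> \<union> U\<^sub>n)\<close> over all tuples with \<open>U\<^sub>i \<in> P\<^sub>+ (q e\<^sub>i)\<close>,
  where \<open>T = {e\<^sub>1, \<dots>, e\<^sub>n}\<close>; tuples are families indexed by \<open>T\<close>.\<close>

definition ext_sum ::
  "('v, 'e) graph \<Rightarrow> (('v, 'e) graph \<Rightarrow> nat) \<Rightarrow> ('v, 'e) graph \<Rightarrow> 'e set \<Rightarrow> nat" where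
  "ext_sum X \<theta> J T = (\<Sum>U \<in> (\<Pi>\<^sub>E e\<in>T. P_plus (next_edges X e)). \<theta> (add_edges J (\<Union>e\<in>T. U e)))"


section \<open>\<open>\<Gamma>\<close>-graphs and occurrences\<close>

definition graph_morphism ::
  "('v, 'e) graph \<Rightarrow> ('w, 'f) graph \<Rightarrow> ('v \<Rightarrow> 'w) \<times> ('e \<Rightarrow> 'f) \<Rightarrow> bool" where
  "graph_morphism G H f \<longleftrightarrow> is_graph G \<and> is_graph H \<and>
     fst f ` verts G \<subseteq> verts H \<and> snd f ` edges G \<subseteq> edges H \<and>
     (\<forall>e\<in>edges G. org H (snd f e) = fst f (org G e) \<and>
                  ter H (snd f e) = fst f (ter G e) \<and>
                  einv H (snd f e) = snd f (einv G e))"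

text \<open>A \<open>\<Gamma>\<close>-graph \<open>\<Delta>\<close> with structure morphism \<open>\<tau>\<close> satisfies \<open>graph_morphism \<Delta> \<Gamma> \<tau>\<close>.\<close>

definition gamma_morphism ::
  "('v, 'e) graph \<Rightarrow> ('v \<Rightarrow> 'a) \<times> ('e \<Rightarrow> 'b) \<Rightarrow> ('w, 'f) graph \<Rightarrow> ('w \<Rightarrow> 'a) \<times> ('f \<Rightarrow> 'b) \<Rightarrow>
   ('v \<Rightarrow> 'w) \<times> ('e \<Rightarrow> 'f) \<Rightarrow> bool" where
  "gamma_morphism \<Delta>1 \<tau>1 \<Delta>2 \<tau>2 f \<longleftrightarrow> graph_morphism \<Delta>1 \<Delta>2 f \<and>
     (\<forall>v\<in>verts \<Delta>1. fst \<tau>1 v = fst \<tau>2 (fst f v)) \<and>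
     (\<forall>e\<in>edges \<Delta>1. snd \<tau>1 e = snd \<tau>2 (snd f e))"

definition folded :: "('w, 'f) graph \<Rightarrow> ('w \<Rightarrow> 'v) \<times> ('f \<Rightarrow> 'e) \<Rightarrow> bool" where
  "folded \<Delta> \<tau> \<longleftrightarrow> (\<forall>x\<in>verts \<Delta>. inj_on (snd \<tau>) (out_edges \<Delta> x))"

definition Lk :: "('w, 'f) graph \<Rightarrow> ('w \<Rightarrow> 'v) \<times> ('f \<Rightarrow> 'e) \<Rightarrow> 'w \<Rightarrow> 'e set" where
  "Lk \<Delta> \<tau> x = snd \<tau> ` out_edges \<Delta> x"

definition cyclically_reduced ::
  "('v, 'e) graph \<Rightarrow> ('w, 'f) graph \<Rightarrow> ('w \<Rightarrow> 'v) \<times> ('f \<Rightarrow> 'e) \<Rightarrow> bool" where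
  "cyclically_reduced \<Gamma> \<Delta> \<tau> \<longleftrightarrow>
     finite_graph \<Delta> \<and> verts \<Delta> \<noteq> {} \<and> graph_morphism \<Delta> \<Gamma> \<tau> \<and> folded \<Delta> \<tau> \<and>
     (\<forall>x\<in>verts \<Delta>. degree \<Delta> x \<ge> 2)"

text \<open>Occurrences are taken to be extensional outside \<open>K\<close> so that they can be counted.\<close>

definition occurrences ::
  "('v, 'e) graph \<Rightarrow> ('v \<Rightarrow> 'a) \<times> ('e \<Rightarrow> 'b) \<Rightarrow> ('w, 'f) graph \<Rightarrow> ('w \<Rightarrow> 'a) \<times> ('f \<Rightarrow> 'b) \<Rightarrow>
   (('v \<Rightarrow> 'w) \<times> ('e \<Rightarrow> 'f)) set" where
  "occurrences K \<kappa> \<Delta> \<tau> =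
     {f. fst f \<in> extensional (verts K) \<and> snd f \<in> extensional (edges K) \<and>
         gamma_morphism K \<kappa> \<Delta> \<tau> f \<and>
         (\<forall>x\<in>verts K. degree K x \<ge> 2 \<longrightarrow> Lk K \<kappa> x = Lk \<Delta> \<tau> (fst f x))}"

end

theory Submission
  imports Defs
begin

text \<open>Call the members of \<open>\<B> X r\<close> balls of radius \<open>r\<close>; they are subtrees, not necessarily full balls
of the metric. Fix the centre \<open>p\<close> of such a ball \<open>K\<close>. The labels of the reduced paths of \<open>K\<close> that start at \<open>p\<close> form a set \<open>T\<close> of words, closed under prefixes, all of whose maximal
words have length \<open>r\<close>. Covering transformations act transitively on the vertices over a given
vertex of \<open>\<Gamma>\<close>, so condition (1) makes \<open>\<theta> K\<close> a function of \<open>T\<close> alone. Up to translation there are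
finitely many such \<open>T\<close>.

The graph \<open>\<Delta>\<close> has \<open>\<theta> T\<close> vertices of type \<open>T\<close>, and a vertex of type \<open>T\<close> is to have one outgoing
edge for every one-letter word \<open>[a]\<close> of \<open>T\<close>. It remains to say which edges are inverse to each
other. The letter \<open>a\<close> cuts \<open>T\<close> into the near half, the words of length less than \<open>r\<close> that do not
start with \<open>a\<close>, and the far half, the words that follow an initial \<open>a\<close>. Together they describe the
part of \<open>K\<close> within distance \<open>r - 1/2\<close> of the midpoint of the edge \<open>a\<close> at the centre. Seen from
the other end of this edge the same tree has the inverse letter and the halves exchanged. Condition (2), for the
tree \<open>J\<close> with these two halves, says that the edges of \<open>\<Delta>\<close> with letter \<open>a\<close> and halves \<open>(A, B)\<close> are
as many as those with letter \<open>a\<^sup>-\<^sup>1\<close> and halves \<open>(B, A)\<close>: the trees \<open>J \<union> U\<^sub>1 \<union> \<dots> \<union> U\<^sub>n\<close> are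
the balls centred at one end of \<open>a\<close> with this trace around \<open>a\<close>, the trees \<open>J \<union> V\<^sub>1 \<union> \<dots> \<union> V\<^sub>m\<close>
those centred at the other end (\<open>ext_sum_join\<close>, \<open>balance_halves\<close>). Hence the edges can be paired,
and no edge is paired with itself because \<open>a\<^sup>-\<^sup>1 \<noteq> a\<close> (\<open>matching_involution\<close>).

In the glued graph, the words of length at most \<open>r\<close> that can be read from a vertex of type \<open>T\<close> are
exactly those of \<open>T\<close> (\<open>language_eq\<close>): crossing an edge reduces the claim to a shorter word at a
vertex whose type has the same trace around that edge. As the graph is folded, an occurrence of
\<open>K\<close> is determined by the image \<open>x\<close> of the centre, and \<open>x\<close> arises in this way exactly if its words
of length at most \<open>r\<close> are those of \<open>K\<close> (\<open>card_occurrences\<close>). So \<open>K\<close> occurs once for each vertex of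
its type, which is \<open>\<theta> K\<close> times.\<close>

section \<open>Free reduction\<close>

lemma reduced_Nil [simp]: "reduced \<iota> []"
  by (simp add: reduced_def)

lemma reduced_Cons: "reduced \<iota> (a # w) \<longleftrightarrow> (w \<noteq> [] \<longrightarrow> hd w \<noteq> \<iota> a) \<and> reduced \<iota> w"
  by (cases w) (auto simp: reduced_def)

lemma reduced_append:
  "reduced \<iota> (u @ w) \<longleftrightarrow>
     reduced \<iota> u \<and> reduced \<iota> w \<and> (u \<noteq> [] \<and> w \<noteq> [] \<longrightarrow> hd w \<noteq> \<iota> (last u))"
  by (auto simp: reduced_def successively_append_iff)

lemma reduce_Cons: "reduce \<iota> (a # w) = red_cons \<iota> a (reduce \<iota> w)"
  by (simp add: reduce_def)

lemma reduce_Nil [simp]: "reduce \<iota> [] = []"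
  by (simp add: reduce_def)

lemma reduced_red_cons: "reduced \<iota> w \<Longrightarrow> reduced \<iota> (red_cons \<iota> a w)"
  by (auto simp: red_cons_def reduced_Cons split: list.splits)

lemma reduced_reduce [simp]: "reduced \<iota> (reduce \<iota> w)"
  by (induction w) (simp_all add: reduce_Cons reduced_red_cons)

lemma reduce_id: "reduced \<iota> w \<Longrightarrow> reduce \<iota> w = w"
  by (induction w) (auto simp: reduce_Cons reduced_Cons red_cons_def split: list.splits)

lemma reduce_append: "reduce \<iota> (u @ w) = foldr (red_cons \<iota>) u (reduce \<iota> w)"
  by (simp add: reduce_def)

lemma reduce_append_reduce: "reduce \<iota> (u @ reduce \<iota> w) = reduce \<iota> (u @ w)"
  by (simp add: reduce_append reduce_id)

lemma length_reduce: "length (reduce \<iota> w) \<le> length w"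
  by (induction w) (auto simp: reduce_Cons red_cons_def split: list.splits if_splits)

lemma reduced_foldr: "reduced \<iota> z \<Longrightarrow> reduced \<iota> (foldr (red_cons \<iota>) u z)"
  by (induction u) (auto intro: reduced_red_cons)

definition inv_word :: "('a \<Rightarrow> 'a) \<Rightarrow> 'a list \<Rightarrow> 'a list" where
  "inv_word \<iota> w = rev (map \<iota> w)"

text \<open>The inversion need only be an involution on the set of letters that occur in words; this is
  all that the inversion of a graph provides.\<close>

locale involution_on =
  fixes E :: "'a set" and \<iota> :: "'a \<Rightarrow> 'a"
  assumes inv_closed: "a \<in> E \<Longrightarrow> \<iota> a \<in> E"
    and inv_inv: "a \<in> E \<Longrightarrow> \<iota> (\<iota> a) = a"
begin

lemma red_cons_cancel:
  assumes "a \<in> E" "reduced \<iota> w"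
  shows "red_cons \<iota> a (red_cons \<iota> (\<iota> a) w) = w"
  using assms inv_inv[of a]
  by (auto simp: red_cons_def reduced_Cons split: list.splits)

lemma red_cons_cancel':
  assumes "a \<in> E" "reduced \<iota> w"
  shows "red_cons \<iota> (\<iota> a) (red_cons \<iota> a w) = w"
  using red_cons_cancel[of "\<iota> a" w] assms inv_inv inv_closed by simp

lemma foldr_reduce:
  assumes "set u \<subseteq> E" "reduced \<iota> z"
  shows "foldr (red_cons \<iota>) (reduce \<iota> u) z = foldr (red_cons \<iota>) u z"
  using assms(1)
proof (induction u)
  case (Cons a u)
  let ?v = "reduce \<iota> u"
  have "foldr (red_cons \<iota>) (red_cons \<iota> a ?v) z = red_cons \<iota> a (foldr (red_cons \<iota>) ?v z)"
  proof (cases "\<exists>v'. ?v = \<iota> a # v'")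
    case True
    then obtain v' where v': "?v = \<iota> a # v'" by blast
    then have "red_cons \<iota> a ?v = v'" by (simp add: red_cons_def)
    moreover have "red_cons \<iota> a (red_cons \<iota> (\<iota> a) (foldr (red_cons \<iota>) v' z)) = foldr (red_cons \<iota>) v' z"
      using red_cons_cancel Cons.prems reduced_foldr[OF assms(2)] by simp
    ultimately show ?thesis using v' by simp
  next
    case False
    then show ?thesis by (auto simp: red_cons_def split: list.splits)
  qed
  then show ?case using Cons by (simp add: reduce_Cons)
qed simp

lemma reduce_reduce_append:
  "set u \<subseteq> E \<Longrightarrow> reduce \<iota> (reduce \<iota> u @ w) = reduce \<iota> (u @ w)"
  by (simp add: reduce_append foldr_reduce)

lemma set_inv_word: "set w \<subseteq> E \<Longrightarrow> set (inv_word \<iota> w) \<subseteq> E"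
  by (auto simp: inv_word_def inv_closed)

lemma inv_word_inv_word: "set w \<subseteq> E \<Longrightarrow> inv_word \<iota> (inv_word \<iota> w) = w"
  by (induction w) (auto simp: inv_word_def inv_inv)

lemma reduce_inv_word_append:
  assumes "set w \<subseteq> E"
  shows "reduce \<iota> (inv_word \<iota> w @ w @ z) = reduce \<iota> z"
  using assms
proof (induction w)
  case (Cons a w)
  have "reduce \<iota> (inv_word \<iota> (a # w) @ (a # w) @ z) =
        foldr (red_cons \<iota>) (inv_word \<iota> w) (red_cons \<iota> (\<iota> a) (red_cons \<iota> a (reduce \<iota> (w @ z))))"
    by (simp add: inv_word_def reduce_append reduce_Cons)
  also have "\<dots> = reduce \<iota> (inv_word \<iota> w @ w @ z)"
    using Cons.prems by (simp add: red_cons_cancel' reduce_append[of _ "inv_word \<iota> w"])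
  finally show ?case using Cons by simp
qed (simp add: inv_word_def)

lemma reduce_append_inv_word:
  assumes "set w \<subseteq> E"
  shows "reduce \<iota> (w @ inv_word \<iota> w @ z) = reduce \<iota> z"
  using reduce_inv_word_append[OF set_inv_word[OF assms], of z] inv_word_inv_word[OF assms]
  by simp

lemma reduce_append_cancel:
  assumes "set u \<subseteq> E" "reduce \<iota> (u @ w) = reduce \<iota> (u @ w')"
  shows "reduce \<iota> w = reduce \<iota> w'"
proof -
  have "reduce \<iota> (inv_word \<iota> u @ u @ w) = reduce \<iota> (inv_word \<iota> u @ u @ w')"
    using assms(2) reduce_append_reduce[of \<iota> "inv_word \<iota> u"] by metis
  then show ?thesis by (simp add: reduce_inv_word_append[OF assms(1)])
qed

end

section \<open>Walks\<close>

lemma walk_append: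
  "walk G u (p @ q) v \<longleftrightarrow> (\<exists>x. walk G u p x \<and> walk G x q v)" if "is_graph G"
proof (induction p arbitrary: u)
  case Nil
  have "u \<in> verts G" if "walk G u q v"
    using that \<open>is_graph G\<close> by (cases q) (auto simp: is_graph_def)
  then show ?case by auto
qed auto

lemma walk_source: "is_graph G \<Longrightarrow> walk G u p v \<Longrightarrow> u \<in> verts G"
  by (cases p) (auto simp: is_graph_def)

lemma walk_target: "walk G u p v \<Longrightarrow> v \<in> verts G"
  by (induction p arbitrary: u) auto

lemma walk_edges: "walk G u p v \<Longrightarrow> set p \<subseteq> edges G"
  by (induction p arbitrary: u) auto

lemma walk_unique: "walk G u p v \<Longrightarrow> walk G u p v' \<Longrightarrow> v = v'"
  by (induction p arbitrary: u) auto

lemma walk_single: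
  "is_graph G \<Longrightarrow> walk G u [e] v \<longleftrightarrow> e \<in> edges G \<and> org G e = u \<and> ter G e = v"
  by (auto simp: is_graph_def)

lemma walk_snoc:
  "is_graph G \<Longrightarrow> walk G u (p @ [e]) v \<longleftrightarrow> walk G u p (org G e) \<and> e \<in> edges G \<and> ter G e = v"
  by (auto simp: walk_append walk_single simp del: walk.simps)

lemma involution_on_einv: "is_graph G \<Longrightarrow> involution_on (edges G) (einv G)"
  by (auto simp: involution_on_def is_graph_def)

lemma walk_inv_word:
  assumes "is_graph G" "walk G u p v"
  shows "walk G v (inv_word (einv G) p) u"
  using assms(2)
proof (induction p arbitrary: u)
  case Nil
  then show ?case by (auto simp: inv_word_def)
next
  case (Cons e p)
  then have "walk G v (inv_word (einv G) p) (ter G e)" by simp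
  with Cons.prems assms(1) show ?case
    by (auto simp: inv_word_def walk_append is_graph_def)
qed

lemma walk_red_cons:
  assumes "is_graph G" "e \<in> edges G" "walk G (ter G e) w v"
  shows "walk G (org G e) (red_cons (einv G) e w) v"
  using assms by (auto simp: red_cons_def is_graph_def split: list.splits)

lemma walk_reduce:
  assumes "is_graph G" "walk G u w v"
  shows "walk G u (reduce (einv G) w) v"
  using assms(2)
  by (induction w arbitrary: u) (use assms(1) walk_red_cons in \<open>fastforce simp: reduce_Cons\<close>)+

lemma subgraph_walk:
  assumes "subgraph H G" "walk H u p v"
  shows "walk G u p v"
  using assms(2)
proof (induction p arbitrary: u)
  case Nil
  then show ?case using assms(1) by (auto simp: subgraph_def)
next
  case (Cons e p)
  then show ?case using assms(1) by (auto simp: subgraph_def)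
qed

section \<open>The universal cover\<close>

locale based_graph =
  fixes \<Gamma> :: "('v, 'e) graph" and v0 :: 'v
  assumes graph: "is_graph \<Gamma>"
begin

abbreviation X where "X \<equiv> univ_cover \<Gamma> v0"
abbreviation \<iota> where "\<iota> \<equiv> einv \<Gamma>"
abbreviation ep where "ep \<equiv> endpoint \<Gamma> v0"

sublocale involution_on "edges \<Gamma>" \<iota>
  using graph by (rule involution_on_einv)

text \<open>If \<open>p\<close> is a vertex of the universal cover and \<open>w\<close> is an edge-path of \<open>\<Gamma>\<close> starting below it,
  then \<open>p \<cdot> w\<close> is the end of the lift of \<open>w\<close> that starts at \<open>p\<close>. If \<open>w\<close> is a closed path at
  the base vertex, then \<open>w \<cdot> p\<close> is the image of \<open>p\<close> under the covering transformation given by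
  \<open>w\<close>.\<close>

definition act :: "'e list \<Rightarrow> 'e list \<Rightarrow> 'e list" (infixl \<open>\<cdot>\<close> 75) where
  "p \<cdot> w = reduce \<iota> (p @ w)"

lemma endpoint_eq: "walk \<Gamma> v0 p v \<Longrightarrow> ep p = v"
  by (cases p rule: rev_cases) (auto simp: endpoint_def walk_snoc graph)

lemma verts_X: "p \<in> verts X \<longleftrightarrow> reduced \<iota> p \<and> walk \<Gamma> v0 p (ep p)"
  using endpoint_eq by (auto simp: univ_cover_def)

lemma edges_X: "(p, e) \<in> edges X \<longleftrightarrow> p \<in> verts X \<and> e \<in> edges \<Gamma> \<and> org \<Gamma> e = ep p"
  by (auto simp: univ_cover_def) (auto simp: endpoint_eq)

lemma org_X [simp]: "org X (p, e) = p"
  and ter_X [simp]: "ter X (p, e) = p \<cdot> [e]"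
  and einv_X [simp]: "einv X (p, e) = (p \<cdot> [e], \<iota> e)"
  by (simp_all add: univ_cover_def act_def)

lemma vert_letters: "p \<in> verts X \<Longrightarrow> set p \<subseteq> edges \<Gamma>"
  using walk_edges[of \<Gamma> v0 p] by (auto simp: verts_X)

lemma act_walk:
  assumes "p \<in> verts X" "walk \<Gamma> (ep p) w v"
  shows "walk \<Gamma> v0 (p \<cdot> w) v"
  using assms by (auto simp: act_def verts_X walk_append graph intro!: walk_reduce)

lemma endpoint_act:
  assumes "p \<in> verts X" "walk \<Gamma> (ep p) w v"
  shows "ep (p \<cdot> w) = v"
  using act_walk[OF assms] by (rule endpoint_eq)

lemma act_vert:
  assumes "p \<in> verts X" "walk \<Gamma> (ep p) w v"
  shows "p \<cdot> w \<in> verts X"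
  using act_walk[OF assms] endpoint_eq by (auto simp: verts_X act_def)

lemma act_Nil [simp]: "p \<in> verts X \<Longrightarrow> p \<cdot> [] = p"
  by (simp add: act_def verts_X reduce_id)

lemma act_act:
  assumes "p \<in> verts X" "set w \<subseteq> edges \<Gamma>"
  shows "(p \<cdot> w) \<cdot> u = p \<cdot> (w @ u)"
  using assms vert_letters reduce_reduce_append[of "p @ w" u] by (simp add: act_def)

lemma act_inj:
  assumes "p \<in> verts X" "reduced \<iota> w" "reduced \<iota> w'" "p \<cdot> w = p \<cdot> w'"
  shows "w = w'"
  using reduce_append_cancel[OF vert_letters[OF assms(1)], of w w'] assms
  by (simp add: act_def reduce_id)

lemma act_cancel:
  assumes "p \<in> verts X" "set w \<subseteq> edges \<Gamma>" "a \<in> edges \<Gamma>"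
  shows "p \<cdot> (w @ [a, \<iota> a] @ u) = p \<cdot> (w @ u)"
proof -
  have "reduce \<iota> ([a, \<iota> a] @ u) = reduce \<iota> u"
    using reduce_append_inv_word[of "[a]" u] assms by (simp add: inv_word_def)
  then show ?thesis
    unfolding act_def using reduce_append_reduce[of \<iota> "p @ w"] by (metis append.assoc)
qed

lemma act_edge_back:
  assumes "p \<in> verts X" "a \<in> edges \<Gamma>"
  shows "p \<cdot> [a] \<cdot> [\<iota> a] = p"
  using act_cancel[of p "[]" a "[]"] assms by (simp add: act_act)

lemma walk_edge: "e \<in> edges \<Gamma> \<Longrightarrow> walk \<Gamma> (org \<Gamma> e) [e] (ter \<Gamma> e)"
  using graph by (auto simp: is_graph_def)

lemma ter_edge_X:
  assumes "(p, e) \<in> edges X"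
  shows "p \<cdot> [e] \<in> verts X" "ep (p \<cdot> [e]) = ter \<Gamma> e"
  using assms act_vert[of p "[e]" "ter \<Gamma> e"] endpoint_act[of p "[e]" "ter \<Gamma> e"] walk_edge
  by (auto simp: edges_X)

lemma graph_X: "is_graph X"
  unfolding is_graph_def
proof
  fix x assume "x \<in> edges X"
  moreover obtain p e where x: "x = (p, e)" by (cases x)
  ultimately have e: "(p, e) \<in> edges X" by simp
  moreover have "\<iota> e \<in> edges \<Gamma>" "\<iota> e \<noteq> e" "\<iota> (\<iota> e) = e" "org \<Gamma> (\<iota> e) = ter \<Gamma> e"
    using e graph by (auto simp: edges_X is_graph_def)
  ultimately show "org X x \<in> verts X \<and> ter X x \<in> verts X \<and> einv X x \<in> edges X \<and>
      einv X x \<noteq> x \<and> einv X (einv X x) = x \<and> org X (einv X x) = ter X x \<and>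
      ter X (einv X x) = org X x"
    using ter_edge_X[OF e] by (auto simp: x edges_X act_edge_back)
qed

lemma walk_X_label:
  assumes "p \<in> verts X" "walk X p es q"
  shows "walk \<Gamma> (ep p) (map snd es) (ep q)" "q = p \<cdot> map snd es"
    "reduced (einv X) es \<longleftrightarrow> reduced \<iota> (map snd es)"
proof -
  have "walk \<Gamma> (ep p) (map snd es) (ep q) \<and> q = p \<cdot> map snd es \<and>
        (reduced (einv X) es \<longleftrightarrow> reduced \<iota> (map snd es))"
    using assms
  proof (induction es arbitrary: p)
    case Nil
    then show ?case using walk_target by (auto simp: verts_X)
  next
    case (Cons x es)
    obtain e where x: "x = (p, e)" using Cons.prems by (cases x) auto
    have e: "(p, e) \<in> edges X" and w: "walk X (p \<cdot> [e]) es q" using Cons.prems x by auto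
    have eG: "e \<in> edges \<Gamma>" "org \<Gamma> e = ep p" using e by (auto simp: edges_X)
    note IH = Cons.IH[OF ter_edge_X(1)[OF e] w]
    have "hd es \<noteq> einv X x \<longleftrightarrow> hd (map snd es) \<noteq> \<iota> e" if "es \<noteq> []"
      using w that x by (cases es) auto
    then show ?case
      using IH eG Cons.prems(1) ter_edge_X[OF e]
      by (auto simp: reduced_Cons x act_act)
  qed
  then show "walk \<Gamma> (ep p) (map snd es) (ep q)" "q = p \<cdot> map snd es"
    "reduced (einv X) es \<longleftrightarrow> reduced \<iota> (map snd es)" by auto
qed

lemma lift_exists:
  assumes "p \<in> verts X" "walk \<Gamma> (ep p) w v"
  shows "\<exists>es. walk X p es (p \<cdot> w) \<and> map snd es = w"
  using assms
proof (induction w arbitrary: p)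
  case Nil
  then show ?case by (intro exI[of _ "[]"]) auto
next
  case (Cons e w)
  then have e: "(p, e) \<in> edges X" by (auto simp: edges_X)
  have "walk \<Gamma> (ep (p \<cdot> [e])) w v" using Cons.prems ter_edge_X[OF e] by auto
  from Cons.IH[OF ter_edge_X(1)[OF e] this] obtain es
    where "walk X (p \<cdot> [e]) es (p \<cdot> [e] \<cdot> w)" "map snd es = w" by auto
  then show ?case using e Cons.prems by (intro exI[of _ "(p, e) # es"]) (auto simp: act_act)
qed

text \<open>A shortest path is the lift of the reduction of its label.\<close>

lemma gdist_act:
  assumes "p \<in> verts X" "walk \<Gamma> (ep p) w v" "reduced \<iota> w"
  shows "gdist X p (p \<cdot> w) = length w"
  unfolding gdist_def
proof (rule Least_equality)
  show "\<exists>es. walk X p es (p \<cdot> w) \<and> length es = length w"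
    using lift_exists[OF assms(1,2)] by (metis length_map)
next
  fix n assume "\<exists>es. walk X p es (p \<cdot> w) \<and> length es = n"
  then obtain es where es: "walk X p es (p \<cdot> w)" "length es = n" by blast
  from walk_X_label[OF assms(1) es(1)] have "p \<cdot> w = p \<cdot> reduce \<iota> (map snd es)"
    by (simp add: act_def reduce_append_reduce)
  then have "w = reduce \<iota> (map snd es)" using act_inj assms by auto
  then show "length w \<le> n" using length_reduce[of \<iota> "map snd es"] es(2) by auto
qed

text \<open>Distinct reduced words lead to distinct vertices, so the universal cover has no reduced closed
  paths.\<close>

lemma subgraph_X_tree:
  assumes "subgraph K X" "connected_graph K"
  shows "is_tree K"
  unfolding is_tree_def
proof (intro conjI allI impI)
  fix v es assume es: "walk K v es v \<and> reduced (einv K) es"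
  have "walk X v es v" using subgraph_walk[OF assms(1)] es by blast
  moreover have "einv K = einv X" using assms(1) by (auto simp: subgraph_def)
  moreover have v: "v \<in> verts X" using \<open>walk X v es v\<close> walk_target by fast
  ultimately have "v \<cdot> [] = v \<cdot> map snd es" "reduced \<iota> (map snd es)"
    using walk_X_label[OF v, of es v] es by auto
  then show "es = []" using act_inj[OF v, of "[]" "map snd es"] by auto
qed (fact assms)

section \<open>Subtrees of the universal cover as sets of words\<close>

text \<open>A finite subtree with a chosen vertex \<open>p\<close> is recorded by the labels of its reduced paths from \<open>p\<close>.
The set \<open>words K p\<close> of these labels forgets which lift \<open>p\<close> of its endpoint in \<open>\<Gamma>\<close> was chosen, and
\<open>span\<close> is the way back.\<close>

definition word_tree :: "'v \<Rightarrow> 'e list set \<Rightarrow> bool" where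
  "word_tree v S \<longleftrightarrow> finite S \<and> [] \<in> S \<and> (\<forall>w b. w @ [b] \<in> S \<longrightarrow> w \<in> S) \<and>
     (\<forall>w\<in>S. reduced \<iota> w \<and> (\<exists>u. walk \<Gamma> v w u))"

definition span :: "'e list \<Rightarrow> 'e list set \<Rightarrow> ('e list, 'e list \<times> 'e) graph" where
  "span p S = (let D = {(p \<cdot> w, b) | w b. w @ [b] \<in> S}
     in X\<lparr>verts := act p ` S, edges := D \<union> einv X ` D\<rparr>)"

definition words :: "('e list, 'e list \<times> 'e) graph \<Rightarrow> 'e list \<Rightarrow> 'e list set" where
  "words K p = {w. reduced \<iota> w \<and> (\<exists>es q. walk K p es q \<and> map snd es = w)}"

lemma word_treeD:
  assumes "word_tree v S"
  shows "finite S" "[] \<in> S" "w @ [b] \<in> S \<Longrightarrow> w \<in> S" "w \<in> S \<Longrightarrow> reduced \<iota> w"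
    "w \<in> S \<Longrightarrow> \<exists>u. walk \<Gamma> v w u" "w \<in> S \<Longrightarrow> set w \<subseteq> edges \<Gamma>"
  using assms walk_edges unfolding word_tree_def by metis+

lemma word_tree_prefix: "word_tree v S \<Longrightarrow> w @ u \<in> S \<Longrightarrow> w \<in> S"
proof (induction u rule: rev_induct)
  case (snoc b u)
  then show ?case using word_treeD(3)[of v S "w @ u" b] by auto
qed simp

lemma span_simps [simp]:
  "org (span p S) = org X" "ter (span p S) = ter X" "einv (span p S) = einv X"
  "verts (span p S) = act p ` S"
  by (simp_all add: span_def Let_def)

text \<open>In a connected subgraph every vertex is the end of a reduced walk from \<open>p\<close>. An edge out of that
vertex either prolongs the walk or is the inverse of its last edge, so no edge is missed.\<close>

lemma subtree_words:
  assumes K: "nondeg_finite_subtree X K" and p: "p \<in> verts K"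
  shows "word_tree (ep p) (words K p)" "span p (words K p) = K"
proof -
  let ?S = "words K p"
  have sub: "subgraph K X" and fin: "finite (verts K)" and con: "connected_graph K"
    and gK: "is_graph K"
    using K by (auto simp: nondeg_finite_subtree_def finite_graph_def is_tree_def)
  have KX [simp]: "org K = org X" "ter K = ter X" "einv K = einv X"
    using sub by (auto simp: subgraph_def)
  have pX: "p \<in> verts X" using sub p by (auto simp: subgraph_def)
  have toX: "walk X p es q" if "walk K p es q" for es q
    using that subgraph_walk[OF sub] by blast
  note lab = walk_X_label[OF pX toX]
  have inS: "p \<cdot> w \<in> verts K" "reduced \<iota> w" "walk \<Gamma> (ep p) w (ep (p \<cdot> w))"
    "\<exists>es. walk K p es (p \<cdot> w) \<and> map snd es = w" if w: "w \<in> ?S" for w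
  proof -
    obtain es q where es: "walk K p es q" "map snd es = w" "reduced \<iota> w"
      using w by (auto simp: words_def)
    then show "p \<cdot> w \<in> verts K" "reduced \<iota> w" "walk \<Gamma> (ep p) w (ep (p \<cdot> w))"
      "\<exists>es. walk K p es (p \<cdot> w) \<and> map snd es = w"
      using lab(1,2)[OF es(1)] walk_target[OF es(1)] by auto
  qed
  show wt: "word_tree (ep p) ?S"
    unfolding word_tree_def
  proof (intro conjI ballI allI impI)
    have "inj_on (act p) ?S" using act_inj[OF pX] inS(2) by (auto intro: inj_onI)
    moreover have "act p ` ?S \<subseteq> verts K" using inS(1) by auto
    ultimately show "finite ?S" using fin finite_subset finite_imageD by metis
    have "walk K p [] p" using p by simp
    then show "[] \<in> ?S" unfolding words_def by force
    fix w assume "w \<in> ?S"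
    then show "reduced \<iota> w" "\<exists>u. walk \<Gamma> (ep p) w u" using inS by blast+
  next
    fix w b assume wb: "w @ [b] \<in> ?S"
    then obtain es q where es: "walk K p es q" "map snd es = w @ [b]" by (auto simp: words_def)
    then obtain es' e where "es = es' @ [e]" "map snd es' = w"
      by (cases es rule: rev_cases) auto
    moreover from this have "walk K p es' (org K e)" using es by (simp add: walk_snoc gK)
    moreover have "reduced \<iota> w" using wb by (simp add: words_def reduced_append)
    ultimately show "w \<in> ?S" unfolding words_def by blast
  qed
  have vK: "\<exists>w\<in>?S. q = p \<cdot> w" if q: "q \<in> verts K" for q
  proof -
    obtain es where "walk K p es q" using con p q unfolding connected_graph_def by blast
    then have red: "walk K p (reduce (einv K) es) q" using walk_reduce[OF gK] by blast
    moreover have "reduced \<iota> (map snd (reduce (einv K) es))"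
      using lab(3)[OF red] by simp
    ultimately show ?thesis using lab(2) unfolding words_def by blast
  qed
  let ?D = "{(p \<cdot> w, b) | w b. w @ [b] \<in> ?S}"
  have Dsub: "?D \<subseteq> edges K"
  proof clarify
    fix w b assume "w @ [b] \<in> ?S"
    then obtain es q where es: "walk K p es q" "map snd es = w @ [b]" by (auto simp: words_def)
    then obtain es' e where e: "es = es' @ [e]" "map snd es' = w" "snd e = b"
      by (cases es rule: rev_cases) auto
    then have "walk K p es' (org K e)" "e \<in> edges K"
      using es by (auto simp: walk_snoc gK)
    moreover from this have "org K e = p \<cdot> w" using lab(2) e by blast
    ultimately show "(p \<cdot> w, b) \<in> edges K" using e by (cases e) auto
  qed
  have Ksub: "x \<in> ?D \<union> einv X ` ?D" if xK: "x \<in> edges K" for x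
  proof -
    obtain q b where x: "x = (q, b)" by (cases x)
    have xX: "(q, b) \<in> edges X" using xK sub x by (auto simp: subgraph_def)
    have bG: "b \<in> edges \<Gamma>" "org \<Gamma> b = ep q" using xX by (auto simp: edges_X)
    have "q \<in> verts K" using xK x gK by (force simp: is_graph_def)
    then obtain w where w: "w \<in> ?S" "q = p \<cdot> w" using vK by blast
    then obtain es where es: "walk K p es q" "map snd es = w" using inS by blast
    show ?thesis
    proof (cases "w \<noteq> [] \<and> last w = \<iota> b")
      case True
      then obtain w' where w': "w = w' @ [\<iota> b]" by (metis append_butlast_last_id)
      have "w' \<in> ?S" using word_treeD(3)[OF wt] w w' by blast
      moreover have "\<iota> b \<in> edges \<Gamma>" using bG inv_closed by blast
      moreover have "set w' \<subseteq> edges \<Gamma>" using \<open>w' \<in> ?S\<close> word_treeD(6)[OF wt] by blast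
      ultimately have "einv X (p \<cdot> w', \<iota> b) = x"
        using x w w' bG pX by (simp add: act_act inv_inv)
      then show ?thesis using w w' by blast
    next
      case False
      have "walk K p (es @ [x]) (ter K x)" using es xK x by (simp add: walk_snoc gK)
      moreover have "reduced \<iota> (w @ [b])"
        using False w inS(2) inv_inv[of "last w"] subsetD[OF word_treeD(6)[OF wt w(1)] last_in_set]
        by (auto simp: reduced_append reduced_Cons)
      ultimately have "w @ [b] \<in> ?S" using es(2) x unfolding words_def
        by (auto intro!: exI[of _ "es @ [x]"])
      then show ?thesis using x w by blast
    qed
  qed
  have inv: "einv X x \<in> edges K" if "x \<in> edges K" for x
    using that gK by (auto simp: is_graph_def)
  have "einv X ` ?D \<subseteq> edges K"
    by (rule image_subsetI, rule inv, erule subsetD[OF Dsub])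
  with Dsub Ksub have "edges K = ?D \<union> einv X ` ?D"
    using Un_least[OF Dsub] subsetI[OF Ksub] by (intro equalityI)
  moreover have "verts K = act p ` ?S" using vK inS(1) by fast
  ultimately show "span p ?S = K"
    using KX by (intro graph.equality) (simp_all add: span_def Let_def)
qed

text \<open>The link of the vertex \<open>p \<cdot> w\<close> of \<open>span p S\<close>: the letters that lead away from \<open>p\<close>, and the one that
leads back.\<close>

definition letters_at :: "'e list set \<Rightarrow> 'e list \<Rightarrow> 'e set" where
  "letters_at S w = {b. w @ [b] \<in> S} \<union> (if w = [] then {} else {\<iota> (last w)})"

lemma word_tree_walk:
  assumes "p \<in> verts X" "word_tree (ep p) S" "w \<in> S"
  shows "walk \<Gamma> (ep p) w (ep (p \<cdot> w))" "p \<cdot> w \<in> verts X"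
  using word_treeD(5)[OF assms(2,3)] endpoint_act[OF assms(1)] act_vert[OF assms(1)] by auto

lemma span_act_inj:
  assumes "p \<in> verts X" "word_tree (ep p) S" "w \<in> S" "w' \<in> S" "p \<cdot> w = p \<cdot> w'"
  shows "w = w'"
  using act_inj[OF assms(1)] word_treeD(4)[OF assms(2)] assms(3-5) by auto

lemma word_tree_snoc_walk:
  assumes "word_tree v S" "w @ [b] \<in> S"
  shows "b \<in> edges \<Gamma>" "walk \<Gamma> v w (org \<Gamma> b)" "walk \<Gamma> v (w @ [b]) (ter \<Gamma> b)"
  using word_treeD(5)[OF assms] by (auto simp: walk_snoc graph)

lemma edges_span:
  "edges (span p S) = {(p \<cdot> w, b) | w b. w @ [b] \<in> S} \<union> einv X ` {(p \<cdot> w, b) | w b. w @ [b] \<in> S}"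
  by (simp add: span_def Let_def)

text \<open>An edge of the subtree is traversed either away from \<open>p\<close>, which extends the word, or towards
  \<open>p\<close>, which deletes its last letter.\<close>

lemma span_edge_iff:
  assumes p: "p \<in> verts X" and S: "word_tree (ep p) S"
  shows "(q, b) \<in> edges (span p S) \<longleftrightarrow> (\<exists>w\<in>S. q = p \<cdot> w \<and> b \<in> letters_at S w)"
proof
  assume "(q, b) \<in> edges (span p S)"
  then consider (out) w where "q = p \<cdot> w" "w @ [b] \<in> S"
    | (inward) w c where "(q, b) = einv X (p \<cdot> w, c)" "w @ [c] \<in> S"
    unfolding edges_span by auto
  then show "\<exists>w\<in>S. q = p \<cdot> w \<and> b \<in> letters_at S w"
  proof cases
    case out
    then show ?thesis
      using word_treeD(3)[OF S] by (intro bexI[of _ w]) (auto simp: letters_at_def)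
  next
    case inward
    then have "q = p \<cdot> (w @ [c])" "b = \<iota> c"
      using word_treeD(6)[OF S word_treeD(3)[OF S inward(2)]] p by (auto simp: act_act)
    then show ?thesis using inward(2) by (intro bexI[of _ "w @ [c]"]) (auto simp: letters_at_def)
  qed
next
  assume "\<exists>w\<in>S. q = p \<cdot> w \<and> b \<in> letters_at S w"
  then obtain w where w: "w \<in> S" "q = p \<cdot> w" "b \<in> letters_at S w" by blast
  show "(q, b) \<in> edges (span p S)"
  proof (cases "w @ [b] \<in> S")
    case True
    then show ?thesis using w by (auto simp: edges_span)
  next
    case False
    then obtain w' c where w': "w = w' @ [c]" "b = \<iota> c"
      using w(3) by (cases w rule: rev_cases) (auto simp: letters_at_def)
    let ?D = "{(p \<cdot> w, b) | w b. w @ [b] \<in> S}"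
    have "(q, b) = einv X (p \<cdot> w', c)"
      using w w' word_treeD(6)[OF S w(1)] p by (auto simp: act_act)
    moreover have "(p \<cdot> w', c) \<in> ?D" using w w' by blast
    ultimately have "(q, b) \<in> einv X ` ?D" by (rule image_eqI)
    then show ?thesis unfolding edges_span by (rule UnI2)
  qed
qed

lemma span_edge_act_iff:
  assumes "p \<in> verts X" "word_tree (ep p) S" "w \<in> S"
  shows "(p \<cdot> w, b) \<in> edges (span p S) \<longleftrightarrow> b \<in> letters_at S w"
  using span_edge_iff[OF assms(1,2)] span_act_inj[OF assms(1,2,3)] assms(3) by blast

lemma span_edge_X:
  assumes p: "p \<in> verts X" and S: "word_tree (ep p) S" and w: "w \<in> S" and b: "b \<in> letters_at S w"
  shows "(p \<cdot> w, b) \<in> edges X" "p \<cdot> w \<cdot> [b] \<in> verts (span p S)"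
    "(p \<cdot> w \<cdot> [b], \<iota> b) \<in> edges (span p S)"
proof -
  have wE: "set w \<subseteq> edges \<Gamma>" using word_treeD(6)[OF S w] .
  have "(p \<cdot> w, b) \<in> edges X \<and> p \<cdot> w \<cdot> [b] \<in> verts (span p S) \<and>
    (p \<cdot> w \<cdot> [b], \<iota> b) \<in> edges (span p S)"
  proof (cases "w @ [b] \<in> S")
    case True
    have "org \<Gamma> b = ep (p \<cdot> w)"
      using word_tree_snoc_walk(2)[OF S True] word_tree_walk(1)[OF p S w] walk_unique by fast
    moreover have "p \<cdot> w \<cdot> [b] = p \<cdot> (w @ [b])" using p wE by (simp add: act_act)
    moreover have "(p \<cdot> (w @ [b]), \<iota> b) \<in> edges (span p S)"
      using span_edge_act_iff[OF p S True] by (simp add: letters_at_def)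
    ultimately show ?thesis
      using word_tree_walk(2)[OF p S w] word_tree_snoc_walk(1)[OF S True] True
      by (auto simp: edges_X)
  next
    case False
    then obtain w' c where w': "w = w' @ [c]" "b = \<iota> c"
      using b by (cases w rule: rev_cases) (auto simp: letters_at_def)
    have cE: "c \<in> edges \<Gamma>" and w'S: "w' \<in> S" using wE w' w word_treeD(3)[OF S] by auto
    have "ter \<Gamma> c = ep (p \<cdot> w)"
      using word_tree_snoc_walk(3)[OF S] word_tree_walk(1)[OF p S w] walk_unique w' w by fast
    then have "org \<Gamma> b = ep (p \<cdot> w)" using graph cE w' by (auto simp: is_graph_def)
    moreover have inward: "p \<cdot> w \<cdot> [b] = p \<cdot> w'"
      using act_cancel[OF p _ cE, of w' "[]"] wE p w' by (simp add: act_act)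
    moreover have "(p \<cdot> w', c) \<in> edges (span p S)"
      using span_edge_act_iff[OF p S w'S] w' w by (simp add: letters_at_def)
    ultimately show ?thesis
      using word_tree_walk(2)[OF p S w] w'S inv_closed[OF cE] w' inv_inv[OF cE]
      by (auto simp: edges_X)
  qed
  then show "(p \<cdot> w, b) \<in> edges X" "p \<cdot> w \<cdot> [b] \<in> verts (span p S)"
    "(p \<cdot> w \<cdot> [b], \<iota> b) \<in> edges (span p S)" by auto
qed

lemma span_subgraph:
  assumes p: "p \<in> verts X" and S: "word_tree (ep p) S"
  shows "is_graph (span p S)" "subgraph (span p S) X"
proof -
  have eX: "x \<in> edges X \<and> org X x \<in> verts (span p S) \<and> ter X x \<in> verts (span p S) \<and>
      einv X x \<in> edges (span p S)" if "x \<in> edges (span p S)" for x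
  proof -
    obtain q b where x: "x = (q, b)" by (cases x)
    then obtain w where w: "w \<in> S" "q = p \<cdot> w" "b \<in> letters_at S w"
      using span_edge_iff[OF p S] \<open>x \<in> edges (span p S)\<close> by auto
    then show ?thesis using span_edge_X[OF p S w(1,3)] x by simp
  qed
  have "verts (span p S) \<subseteq> verts X" using word_tree_walk(2)[OF p S] by auto
  with eX graph_X show "is_graph (span p S)" unfolding is_graph_def by simp
  with eX \<open>verts (span p S) \<subseteq> verts X\<close> show "subgraph (span p S) X"
    unfolding subgraph_def by auto
qed

lemma span_walk:
  assumes p: "p \<in> verts X" and S: "word_tree (ep p) S" and w: "w \<in> S"
  shows "\<exists>es. walk (span p S) p es (p \<cdot> w) \<and> map snd es = w"
  using w
proof (induction w rule: rev_induct)
  case Nil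
  have "p \<cdot> [] \<in> verts (span p S)" using Nil by (simp del: act_Nil)
  then show ?case using p by (intro exI[of _ "[]"]) simp
next
  case (snoc b w)
  have wS: "w \<in> S" using word_treeD(3)[OF S snoc.prems] .
  then obtain es where es: "walk (span p S) p es (p \<cdot> w)" "map snd es = w" using snoc.IH by blast
  have "(p \<cdot> w, b) \<in> edges (span p S)"
    using span_edge_act_iff[OF p S wS] snoc.prems by (simp add: letters_at_def)
  moreover have "p \<cdot> w \<cdot> [b] = p \<cdot> (w @ [b])" using act_act p word_treeD(6)[OF S wS] by simp
  ultimately have "walk (span p S) p (es @ [(p \<cdot> w, b)]) (p \<cdot> (w @ [b]))"
    using es by (simp add: walk_snoc span_subgraph[OF p S])
  then show ?case using es by (intro exI[of _ "es @ [(p \<cdot> w, b)]"]) simp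
qed

lemma span_nondeg_finite_subtree:
  assumes p: "p \<in> verts X" and S: "word_tree (ep p) S" and a: "[a] \<in> S"
  shows "nondeg_finite_subtree X (span p S)"
proof -
  let ?K = "span p S"
  note g = span_subgraph[OF p S]
  have "connected_graph ?K"
    unfolding connected_graph_def
  proof (intro conjI ballI)
    show "is_graph ?K" using g by simp
    show "verts ?K \<noteq> {}" using word_treeD(2)[OF S] by auto
    fix u v assume "u \<in> verts ?K" "v \<in> verts ?K"
    then have "\<exists>es. walk ?K p es u" "\<exists>fs. walk ?K p fs v" using span_walk[OF p S] by auto
    then show "\<exists>p. walk ?K u p v" using walk_inv_word[OF g(1)] walk_append[OF g(1)] by blast
  qed
  moreover have "edges ?K \<noteq> {}"
    using span_edge_act_iff[OF p S word_treeD(2)[OF S], of a] a by (auto simp: letters_at_def)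
  moreover have "finite (edges ?K)"
  proof -
    have "{(p \<cdot> w, b) | w b. w @ [b] \<in> S} \<subseteq> (\<lambda>w. (p \<cdot> butlast w, last w)) ` S" by force
    then have "finite {(p \<cdot> w, b) | w b. w @ [b] \<in> S}"
      using word_treeD(1)[OF S] finite_surj by blast
    then show ?thesis unfolding edges_span by simp
  qed
  ultimately show ?thesis
    using g subgraph_X_tree word_treeD(1)[OF S]
    unfolding nondeg_finite_subtree_def finite_graph_def by auto
qed

lemma out_edges_span:
  assumes "p \<in> verts X" "word_tree (ep p) S" "w \<in> S"
  shows "out_edges (span p S) (p \<cdot> w) = Pair (p \<cdot> w) ` letters_at S w"
  using span_edge_act_iff[OF assms] by (auto simp: out_edges_def)

lemma finite_next_letters:
  assumes "finite S"
  shows "finite {b. w @ [b] \<in> S}"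
proof -
  have "{b. w @ [b] \<in> S} \<subseteq> last ` S" by force
  then show ?thesis using assms finite_surj by blast
qed

lemma degree_span:
  assumes p: "p \<in> verts X" and S: "word_tree (ep p) S" and w: "w \<in> S"
  shows "degree (span p S) (p \<cdot> w) = card {b. w @ [b] \<in> S} + (if w = [] then 0 else 1)"
proof -
  have "degree (span p S) (p \<cdot> w) = card (letters_at S w)"
    unfolding degree_def out_edges_span[OF assms] by (intro card_image inj_onI) simp
  also have "\<dots> = card {b. w @ [b] \<in> S} + (if w = [] then 0 else 1)"
  proof (cases "w = []")
    case False
    then have "\<iota> (last w) \<notin> {b. w @ [b] \<in> S}"
      using word_treeD(4)[OF S, of "w @ [\<iota> (last w)]"] by (auto simp: reduced_append)
    then show ?thesis using False finite_next_letters[OF word_treeD(1)[OF S]]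
      by (auto simp: letters_at_def)
  qed (simp add: letters_at_def)
  finally show ?thesis .
qed

lemma card_ge_2_iff: "finite A \<Longrightarrow> card A \<ge> 2 \<longleftrightarrow> (\<exists>a\<in>A. \<exists>b\<in>A. a \<noteq> b)"
  using card_le_Suc0_iff_eq[of A] by (auto simp: not_less_eq_eq[symmetric] numeral_2_eq_2)

text \<open>At the root there is no letter leading back, hence the two distinct one-letter words.\<close>

lemma terminal_span:
  assumes p: "p \<in> verts X" and S: "word_tree (ep p) S" and w: "w \<in> S"
    and ab: "[a] \<in> S" "[b] \<in> S" "a \<noteq> b"
  shows "p \<cdot> w \<in> terminal_verts (span p S) \<longleftrightarrow> w \<noteq> [] \<and> (\<forall>c. w @ [c] \<notin> S)"
    and "degree (span p S) (p \<cdot> w) \<ge> 2 \<longleftrightarrow> w = [] \<or> (\<exists>c. w @ [c] \<in> S)"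
proof -
  note fin = finite_next_letters[OF word_treeD(1)[OF S]]
  have root: "card {c. w @ [c] \<in> S} \<ge> 2" if "w = []"
    using that ab card_ge_2_iff[OF fin[of "[]"]] by auto
  have inner: "card {c. w @ [c] \<in> S} = 0 \<longleftrightarrow> (\<forall>c. w @ [c] \<notin> S)" using fin[of w] by auto
  show "p \<cdot> w \<in> terminal_verts (span p S) \<longleftrightarrow> w \<noteq> [] \<and> (\<forall>c. w @ [c] \<notin> S)"
    using root inner w unfolding terminal_verts_def by (auto simp: degree_span[OF p S w])
  show "degree (span p S) (p \<cdot> w) \<ge> 2 \<longleftrightarrow> w = [] \<or> (\<exists>c. w @ [c] \<in> S)"
  proof (cases "w = []")
    case True then show ?thesis using root degree_span[OF p S w] by simp
  next
    case False then show ?thesis using inner degree_span[OF p S w] by (auto simp: Suc_le_eq)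
  qed
qed

section \<open>Balls\<close>

text \<open>For \<open>r \<ge> 1\<close>, the word sets of the members of \<open>\<B> X r\<close>, read from their centres. The second condition says that the
centre is not a leaf.\<close>

definition ball_words :: "nat \<Rightarrow> 'v \<Rightarrow> 'e list set \<Rightarrow> bool" where
  "ball_words r v T \<longleftrightarrow> word_tree v T \<and> (\<exists>a b. a \<noteq> b \<and> [a] \<in> T \<and> [b] \<in> T) \<and>
     (\<forall>w\<in>T. length w \<le> r \<and> (length w < r \<longrightarrow> (\<exists>b. w @ [b] \<in> T)))"

lemma ball_words_terminal:
  assumes p: "p \<in> verts X" and T: "ball_words r (ep p) T" and w: "w \<in> T"
  shows "p \<cdot> w \<in> terminal_verts (span p T) \<longleftrightarrow> w \<noteq> [] \<and> length w = r"
    and "degree (span p T) (p \<cdot> w) \<ge> 2 \<longleftrightarrow> w = [] \<or> length w < r"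
proof -
  have S: "word_tree (ep p) T" using T by (simp add: ball_words_def)
  obtain a b where ab: "[a] \<in> T" "[b] \<in> T" "a \<noteq> b" using T by (auto simp: ball_words_def)
  have "(\<exists>c. w @ [c] \<in> T) \<longleftrightarrow> length w < r"
    using T w unfolding ball_words_def by fastforce
  moreover have "length w \<le> r" using T w by (auto simp: ball_words_def)
  ultimately show "p \<cdot> w \<in> terminal_verts (span p T) \<longleftrightarrow> w \<noteq> [] \<and> length w = r"
    "degree (span p T) (p \<cdot> w) \<ge> 2 \<longleftrightarrow> w = [] \<or> length w < r"
    using terminal_span[OF p S w ab] by auto
qed

text \<open>The vertex \<open>p \<cdot> w\<close> has distance \<open>length w\<close> from \<open>p\<close>, and the leaves are the ends of the words of
length \<open>r\<close>.\<close>

lemma span_ball: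
  assumes p: "p \<in> verts X" and T: "ball_words r (ep p) T"
  shows "span p T \<in> \<B> X r"
proof -
  have S: "word_tree (ep p) T" using T by (simp add: ball_words_def)
  obtain a where a: "[a] \<in> T" using T by (auto simp: ball_words_def)
  have "gdist X p v = r" if v: "v \<in> terminal_verts (span p T)" for v
  proof -
    obtain w where w: "w \<in> T" "v = p \<cdot> w" using v by (auto simp: terminal_verts_def)
    then show ?thesis
      using gdist_act[OF p word_tree_walk(1)[OF p S w(1)] word_treeD(4)[OF S w(1)]]
        ball_words_terminal(1)[OF p T w(1)] v by auto
  qed
  moreover have "p \<in> verts (span p T)" using word_treeD(2)[OF S] act_Nil[OF p] by force
  ultimately show ?thesis
    using span_nondeg_finite_subtree[OF p S a] unfolding \<B>_def by blast
qed

text \<open>The vertex \<open>p \<cdot> w\<close> is a leaf as soon as \<open>w\<close> is maximal, and leaves have distance \<open>r\<close> from the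
centre, so maximal words have length \<open>r\<close>. The centre has distance 0 from itself, so it is not a
leaf and has two outgoing edges.\<close>

lemma ball_span:
  assumes K: "K \<in> \<B> X r" and r: "r \<ge> 1"
  shows "\<exists>p\<in>verts X. \<exists>T. ball_words r (ep p) T \<and> K = span p T"
proof -
  obtain p where sub: "nondeg_finite_subtree X K" and pK: "p \<in> verts K"
    and dist: "\<And>v. v \<in> terminal_verts K \<Longrightarrow> gdist X p v = r"
    using K by (auto simp: \<B>_def)
  have p: "p \<in> verts X" using sub pK by (auto simp: nondeg_finite_subtree_def subgraph_def)
  define T where "T = words K p"
  have S: "word_tree (ep p) T" and KT: "K = span p T"
    using subtree_words[OF sub pK] by (auto simp: T_def)
  note fin = finite_next_letters[OF word_treeD(1)[OF S]]
  have leaf: "length w = r" if w: "w \<in> T" and d: "degree K (p \<cdot> w) = 1" for w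
    using dist[of "p \<cdot> w"] w d
      gdist_act[OF p word_tree_walk(1)[OF p S w] word_treeD(4)[OF S w]]
    by (simp add: terminal_verts_def KT)
  have len: "length w \<le> r" if w: "w \<in> T" for w
  proof (rule ccontr)
    assume long: "\<not> length w \<le> r"
    \<comment> \<open>a longest word through \<open>w\<close> ends in a leaf that is too far from \<open>p\<close>\<close>
    have fl: "finite (length ` T)" using word_treeD(1)[OF S] by simp
    then have "Max (length ` T) \<in> length ` T" using w by (intro Max_in) auto
    then obtain u where u: "u \<in> T" "\<And>u'. u' \<in> T \<Longrightarrow> length u' \<le> length u"
      using Max_ge[OF fl] by auto
    have "{b. u @ [b] \<in> T} = {}" using u(2)[of "u @ [_]"] by auto
    then have "degree K (p \<cdot> u) = 1"
      using u w long degree_span[OF p S u(1)] by (force simp: KT)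
    then show False using leaf[OF u(1)] u(2)[OF w] long by simp
  qed
  have ext: "\<exists>b. w @ [b] \<in> T" if w: "w \<in> T" "length w < r" "w \<noteq> []" for w
  proof (rule ccontr)
    assume "\<nexists>b. w @ [b] \<in> T"
    then have "degree K (p \<cdot> w) = 1" using degree_span[OF p S w(1)] w by (simp add: KT)
    then show False using leaf[OF w(1)] w by simp
  qed
  have "\<exists>a. [a] \<in> T"
  proof -
    obtain x where "x \<in> edges K" using sub by (auto simp: nondeg_finite_subtree_def)
    then obtain w b where wb: "w \<in> T" "b \<in> letters_at T w"
      using span_edge_iff[OF p S, of "fst x" "snd x"] by (auto simp: KT)
    then show ?thesis
      using word_tree_prefix[OF S, of "[hd w]" "tl w"] by (cases w) (auto simp: letters_at_def)
  qed
  then obtain a where a: "[a] \<in> T" by blast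
  have "card {b. [] @ [b] \<in> T} \<noteq> 1"
    using leaf[OF word_treeD(2)[OF S]] degree_span[OF p S word_treeD(2)[OF S]] r by (auto simp: KT)
  moreover have "card {b. [] @ [b] \<in> T} \<noteq> 0" using fin[of "[]"] a by auto
  ultimately have "card {b. [] @ [b] \<in> T} \<ge> 2" by linarith
  then obtain a b where "a \<noteq> b" "[a] \<in> T" "[b] \<in> T"
    using card_ge_2_iff[OF fin[of "[]"]] by auto
  then have "ball_words r (ep p) T"
    using S len ext unfolding ball_words_def by (metis append_Nil)
  then show ?thesis using p KT by blast
qed

text \<open>Balls with the same word set whose centres lie over the same vertex of \<open>\<Gamma>\<close> are translates of each
other: the path from the base vertex to \<open>p'\<close> followed by the inverse of the path to \<open>p\<close> is a closed
path whose covering transformation moves \<open>p\<close> to \<open>p'\<close>.\<close>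

lemma translate_span:
  assumes p: "p \<in> verts X" and p': "p' \<in> verts X" and eq: "ep p = ep p'"
    and T: "word_tree (ep p) T"
  defines "h \<equiv> p' \<cdot> inv_word \<iota> p"
  shows "h \<in> carrier (pi1 \<Gamma> v0)" "translate \<Gamma> h (span p T) = span p' T"
proof -
  have wp: "walk \<Gamma> v0 p (ep p)" using p by (simp add: verts_X)
  have inv: "walk \<Gamma> (ep p') (inv_word \<iota> p) v0" using walk_inv_word[OF graph wp] eq by simp
  show "h \<in> carrier (pi1 \<Gamma> v0)"
    using act_walk[OF p' inv] by (simp add: h_def pi1_def) (simp add: act_def)
  have hE: "set h \<subseteq> edges \<Gamma>" using act_walk[OF p' inv] walk_edges by (fastforce simp: h_def)
  \<comment> \<open>left multiplication by \<open>h\<close> is the covering transformation that moves \<open>p\<close> to \<open>p'\<close>\<close>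
  have move: "reduce \<iota> (h @ (p \<cdot> w)) = p' \<cdot> w" for w
  proof -
    have "reduce \<iota> (h @ (p \<cdot> w)) = reduce \<iota> (h @ p @ w)"
      by (simp add: act_def reduce_append_reduce)
    also have "\<dots> = reduce \<iota> ((p' @ inv_word \<iota> p) @ p @ w)"
      unfolding h_def act_def
      using reduce_reduce_append[of "p' @ inv_word \<iota> p"] vert_letters[OF p] vert_letters[OF p']
        set_inv_word by simp
    also have "\<dots> = reduce \<iota> (p' @ reduce \<iota> (inv_word \<iota> p @ p @ w))"
      by (simp add: reduce_append_reduce)
    also have "\<dots> = p' \<cdot> w"
      by (simp add: reduce_inv_word_append[OF vert_letters[OF p]] reduce_append_reduce act_def)
    finally show ?thesis .
  qed
  have T': "word_tree (ep p') T" using T eq by simp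
  have "(\<lambda>(q, e). (reduce \<iota> (h @ q), e)) ` edges (span p T) = edges (span p' T)" (is "?f ` _ = _")
  proof (intro equalityI subsetI)
    fix x assume "x \<in> ?f ` edges (span p T)"
    then obtain q b where "x = (reduce \<iota> (h @ q), b)" "(q, b) \<in> edges (span p T)" by auto
    then show "x \<in> edges (span p' T)"
      using span_edge_iff[OF p T] span_edge_iff[OF p' T'] move by auto
  next
    fix x assume "x \<in> edges (span p' T)"
    then obtain w b where "w \<in> T" "x = (p' \<cdot> w, b)" "b \<in> letters_at T w"
      using span_edge_iff[OF p' T', of "fst x" "snd x"] by (cases x) auto
    then have "x = ?f (p \<cdot> w, b)" "(p \<cdot> w, b) \<in> edges (span p T)"
      using span_edge_iff[OF p T] move by auto
    then show "x \<in> ?f ` edges (span p T)" by blast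
  qed
  moreover have "(\<lambda>q. reduce \<iota> (h @ q)) ` verts (span p T) = verts (span p' T)"
    by (simp add: image_image move)
  ultimately show "translate \<Gamma> h (span p T) = span p' T"
    by (intro graph.equality) (simp_all add: translate_def span_def Let_def)
qed

end

section \<open>Neighbourhoods of edges\<close>

lemma is_graph_delete_edge:
  assumes "is_graph G" "e \<in> edges G"
  shows "is_graph (delete_edge G e)"
  using assms unfolding is_graph_def delete_edge_def by auto metis+

locale finite_based_graph = based_graph \<Gamma> v0 for \<Gamma> :: "('v, 'e) graph" and v0 +
  assumes finite_edges: "finite (edges \<Gamma>)"
begin

text \<open>One side of a tree all of whose leaves have distance \<open>m + 1/2\<close> from the midpoint of an edge,
read from the end \<open>v\<close> of the edge on that side; \<open>a\<close> is the letter that crosses the edge from there.\<close>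

definition half_ball :: "nat \<Rightarrow> 'v \<Rightarrow> 'e \<Rightarrow> 'e list set \<Rightarrow> bool" where
  "half_ball m v a A \<longleftrightarrow> word_tree v A \<and>
     (\<forall>w\<in>A. (w \<noteq> [] \<longrightarrow> hd w \<noteq> a) \<and> length w \<le> m \<and> (length w < m \<longrightarrow> (\<exists>b. w @ [b] \<in> A)))"

text \<open>For an edge \<open>a\<close> at the centre of a ball of radius \<open>m + 1\<close> with word set \<open>T\<close>, the sets \<open>near m a T\<close>
and \<open>far a T\<close> are the two sides of its part within distance \<open>m + 1/2\<close> of the midpoint of this edge, each
read from its own end of \<open>a\<close>. Both have depth \<open>m\<close>: on the far side one letter is spent on crossing
\<open>a\<close>.\<close>

definition near :: "nat \<Rightarrow> 'e \<Rightarrow> 'e list set \<Rightarrow> 'e list set" where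
  "near m a T = {w \<in> T. length w \<le> m \<and> (w \<noteq> [] \<longrightarrow> hd w \<noteq> a)}"

definition far :: "'e \<Rightarrow> 'e list set \<Rightarrow> 'e list set" where
  "far a T = {w. a # w \<in> T}"

definition join :: "'e list set \<Rightarrow> 'e \<Rightarrow> 'e list set \<Rightarrow> 'e list set" where
  "join A a B = A \<union> (#) a ` B"

lemma half_ballI:
  assumes "finite A" "[] \<in> A" "\<And>w b. w @ [b] \<in> A \<Longrightarrow> w \<in> A" "\<And>w. w \<in> A \<Longrightarrow> reduced \<iota> w"
    "\<And>w. w \<in> A \<Longrightarrow> \<exists>u. walk \<Gamma> v w u" "\<And>w. w \<in> A \<Longrightarrow> w \<noteq> [] \<Longrightarrow> hd w \<noteq> a"
    "\<And>w. w \<in> A \<Longrightarrow> length w \<le> m" "\<And>w. w \<in> A \<Longrightarrow> length w < m \<Longrightarrow> \<exists>b. w @ [b] \<in> A"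
  shows "half_ball m v a A"
  unfolding half_ball_def word_tree_def using assms by auto

lemma half_ballD:
  assumes "half_ball m v a A"
  shows "word_tree v A" "w \<in> A \<Longrightarrow> length w \<le> m" "w \<in> A \<Longrightarrow> length w < m \<Longrightarrow> \<exists>b. w @ [b] \<in> A"
    "a # u \<notin> A" "w \<in> A \<Longrightarrow> w \<noteq> [] \<Longrightarrow> hd w \<noteq> a" "[] \<in> A" "w @ [b] \<in> A \<Longrightarrow> w \<in> A"
proof -
  have S: "word_tree v A" and *: "\<And>w. w \<in> A \<Longrightarrow> (w \<noteq> [] \<longrightarrow> hd w \<noteq> a) \<and> length w \<le> m \<and>
      (length w < m \<longrightarrow> (\<exists>b. w @ [b] \<in> A))"
    using assms unfolding half_ball_def by blast+
  show "word_tree v A" "[] \<in> A" "w @ [b] \<in> A \<Longrightarrow> w \<in> A" using S word_treeD by blast+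
  show "w \<in> A \<Longrightarrow> length w \<le> m" "w \<in> A \<Longrightarrow> length w < m \<Longrightarrow> \<exists>b. w @ [b] \<in> A"
    "w \<in> A \<Longrightarrow> w \<noteq> [] \<Longrightarrow> hd w \<noteq> a" using *[of w] by blast+
  show "a # u \<notin> A" using *[of "a # u"] by auto
qed

text \<open>The near half contains more than the empty word because the centre has a second edge.\<close>

lemma ball_half_balls:
  assumes T: "ball_words (Suc m) v T" and a: "[a] \<in> T"
  shows "a \<in> edges \<Gamma>" "v = org \<Gamma> a" "half_ball m (org \<Gamma> a) a (near m a T)"
    "half_ball m (ter \<Gamma> a) (\<iota> a) (far a T)"
proof -
  have S: "word_tree v T" using T by (simp add: ball_words_def)
  note S' = word_treeD[OF S]
  show aE: "a \<in> edges \<Gamma>" and v: "v = org \<Gamma> a" using S'(5)[OF a] by auto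
  have ext: "\<exists>b. w @ [b] \<in> T" if "w \<in> T" "length w \<le> m" for w
    using T that by (auto simp: ball_words_def)
  have len: "length w \<le> Suc m" if "w \<in> T" for w
    using T that by (auto simp: ball_words_def)
  have other: "\<exists>b. [b] \<in> T \<and> b \<noteq> a"
    using T by (auto simp: ball_words_def)
  show "half_ball m (org \<Gamma> a) a (near m a T)"
  proof (rule half_ballI)
    show "\<exists>b. w @ [b] \<in> near m a T" if w: "w \<in> near m a T" "length w < m" for w
    proof (cases "w = []")
      case True
      then show ?thesis using other w by (auto simp: near_def)
    next
      case False
      then show ?thesis using ext[of w] w by (auto simp: near_def)
    qed
    show "w \<in> near m a T" if "w @ [b] \<in> near m a T" for w b
      using that S'(3) by (cases w) (auto simp: near_def)
  qed (use S' v in \<open>auto simp: near_def\<close>)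
  show "half_ball m (ter \<Gamma> a) (\<iota> a) (far a T)"
  proof (rule half_ballI)
    show "finite (far a T)"
      using finite_vimageI[OF S'(1), of "(#) a"] by (simp add: far_def vimage_def)
    show "w \<in> far a T" if "w @ [b] \<in> far a T" for w b
      using that S'(3)[of "a # w" b] by (simp add: far_def)
    show "\<exists>b. w @ [b] \<in> far a T" if "w \<in> far a T" "length w < m" for w
      using that ext[of "a # w"] by (simp add: far_def)
    show "length w \<le> m" if "w \<in> far a T" for w
      using that len[of "a # w"] by (simp add: far_def)
    show "reduced \<iota> w" "w \<noteq> [] \<Longrightarrow> hd w \<noteq> \<iota> a" "\<exists>u. walk \<Gamma> (ter \<Gamma> a) w u"
      if "w \<in> far a T" for w
      using that S'(4,5)[of "a # w"] by (simp_all add: far_def reduced_Cons)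
  qed (simp add: a far_def)
qed

lemma half_ball_swap:
  assumes "a \<in> edges \<Gamma>"
  shows "half_ball m (org \<Gamma> (\<iota> a)) (\<iota> a) B \<longleftrightarrow> half_ball m (ter \<Gamma> a) (\<iota> a) B"
    and "half_ball m (ter \<Gamma> (\<iota> a)) (\<iota> (\<iota> a)) A \<longleftrightarrow> half_ball m (org \<Gamma> a) a A"
  using assms graph by (auto simp: is_graph_def)

context
  fixes m :: nat and a :: 'e and A B :: "'e list set"
  assumes m: "m \<ge> 1" and a: "a \<in> edges \<Gamma>"
    and A: "half_ball m (org \<Gamma> a) a A" and B: "half_ball m (ter \<Gamma> a) (\<iota> a) B"
begin

lemma join_word_tree: "word_tree (org \<Gamma> a) (join A a B)"
proof -
  note A' = half_ballD[OF A] word_treeD[OF half_ballD(1)[OF A]]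
  note B' = half_ballD[OF B] word_treeD[OF half_ballD(1)[OF B]]
  have "w \<in> join A a B" if wb: "w @ [b] \<in> join A a B" for w b
  proof (cases "w @ [b] \<in> A")
    case True
    then show ?thesis using A'(7) by (auto simp: join_def)
  next
    case False
    then obtain u where "w @ [b] = a # u" "u \<in> B" using wb by (auto simp: join_def)
    then show ?thesis using A'(6) B'(7) by (cases w) (auto simp: join_def)
  qed
  moreover have "\<exists>x. walk \<Gamma> (org \<Gamma> a) (a # u) x" if "u \<in> B" for u
    using B'(12)[OF that] a by simp
  moreover have "reduced \<iota> (a # u)" if "u \<in> B" for u
    using B'(5) B'(11) that by (auto simp: reduced_Cons)
  ultimately show ?thesis
    unfolding word_tree_def using A'(6,8,11,12) B'(8)
    by (auto simp: join_def simp del: walk.simps)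
qed

lemma join_letters:
  "w \<in> A \<Longrightarrow> letters_at (join A a B) w = {b. w @ [b] \<in> A} \<union> {if w = [] then a else \<iota> (last w)}"
  "u \<in> B \<Longrightarrow> letters_at (join A a B) (a # u) = {b. u @ [b] \<in> B} \<union> {\<iota> (last (a # u))}"
proof -
  assume w: "w \<in> A"
  have "w @ [b] \<in> join A a B \<longleftrightarrow> w @ [b] \<in> A \<or> w = [] \<and> b = a" for b
    using half_ballD(5)[OF A w] half_ballD(6)[OF B] by (cases w) (auto simp: join_def)
  then show "letters_at (join A a B) w = {b. w @ [b] \<in> A} \<union> {if w = [] then a else \<iota> (last w)}"
    by (auto simp: letters_at_def)
next
  assume u: "u \<in> B"
  have "a # u @ [b] \<in> join A a B \<longleftrightarrow> u @ [b] \<in> B" for b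
    using half_ballD(4)[OF A] by (auto simp: join_def)
  then show "letters_at (join A a B) (a # u) = {b. u @ [b] \<in> B} \<union> {\<iota> (last (a # u))}"
    by (auto simp: letters_at_def)
qed

lemma join_two_letters: "\<exists>b. b \<noteq> a \<and> [a] \<in> join A a B \<and> [b] \<in> join A a B"
proof -
  obtain b where b: "[b] \<in> A" using half_ballD(3,6)[OF A] m by fastforce
  then have "b \<noteq> a" using half_ballD(5)[OF A b] by simp
  then show ?thesis using b half_ballD(6)[OF B] by (auto simp: join_def)
qed

lemma join_extend:
  "w \<in> A \<Longrightarrow> (\<exists>b. w @ [b] \<in> join A a B) \<longleftrightarrow> length w < m"
  "u \<in> B \<Longrightarrow> (\<exists>b. (a # u) @ [b] \<in> join A a B) \<longleftrightarrow> length u < m"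
proof -
  assume w: "w \<in> A"
  show "(\<exists>b. w @ [b] \<in> join A a B) \<longleftrightarrow> length w < m"
  proof (cases "w = []")
    case True
    then show ?thesis using join_two_letters m by auto
  next
    case False
    then have "w @ [b] \<in> join A a B \<longleftrightarrow> w @ [b] \<in> A" for b
      using half_ballD(5)[OF A w] by (cases w) (auto simp: join_def)
    then show ?thesis using half_ballD(2,3)[OF A] w by fastforce
  qed
next
  assume u: "u \<in> B"
  have "a # u @ [b] \<in> join A a B \<longleftrightarrow> u @ [b] \<in> B" for b
    using half_ballD(4)[OF A] by (auto simp: join_def)
  then show "(\<exists>b. (a # u) @ [b] \<in> join A a B) \<longleftrightarrow> length u < m"
    using half_ballD(2,3)[OF B] u by fastforce
qed

lemma join_terminal:
  assumes p: "p \<in> verts X" "ep p = org \<Gamma> a"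
  shows "w \<in> A \<Longrightarrow> p \<cdot> w \<in> terminal_verts (span p (join A a B)) \<longleftrightarrow> length w = m"
    and "u \<in> B \<Longrightarrow> p \<cdot> (a # u) \<in> terminal_verts (span p (join A a B)) \<longleftrightarrow> length u = m"
proof -
  have S: "word_tree (ep p) (join A a B)" using join_word_tree p by simp
  obtain b where b: "[a] \<in> join A a B" "[b] \<in> join A a B" "a \<noteq> b" using join_two_letters by metis
  note trm = terminal_span(1)[OF p(1) S _ b]
  show "p \<cdot> w \<in> terminal_verts (span p (join A a B)) \<longleftrightarrow> length w = m" if "w \<in> A"
    using trm[of w] join_extend(1)[OF that] half_ballD(2)[OF A that] that m
    by (auto simp: join_def)
  show "p \<cdot> (a # u) \<in> terminal_verts (span p (join A a B)) \<longleftrightarrow> length u = m" if "u \<in> B"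
    using trm[of "a # u"] join_extend(2)[OF that] half_ballD(2)[OF B that] that
    by (auto simp: join_def)
qed

end

text \<open>The tree around an edge may be read from either end of that edge: a word of the half at the far end
is the same vertex as its prolongation at the front by the letter that crosses the edge.\<close>

lemma span_join_subset:
  assumes m: "m \<ge> 1" and A: "half_ball m (org \<Gamma> a) a A" and B: "half_ball m (ter \<Gamma> a) (\<iota> a) B"
    and e: "(p, a) \<in> edges X"
  shows "verts (span (p \<cdot> [a]) (join B (\<iota> a) A)) \<subseteq> verts (span p (join A a B))"
    "edges (span (p \<cdot> [a]) (join B (\<iota> a) A)) \<subseteq> edges (span p (join A a B))"
proof -
  have p: "p \<in> verts X" "ep p = org \<Gamma> a" and a: "a \<in> edges \<Gamma>" using e by (auto simp: edges_X)
  have ia: "\<iota> a \<in> edges \<Gamma>" "\<iota> (\<iota> a) = a" using a inv_closed inv_inv by auto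
  have q: "p \<cdot> [a] \<in> verts X" "ep (p \<cdot> [a]) = org \<Gamma> (\<iota> a)"
    using ter_edge_X[OF e] graph a by (auto simp: is_graph_def)
  have A': "half_ball m (ter \<Gamma> (\<iota> a)) (\<iota> (\<iota> a)) A" and B': "half_ball m (org \<Gamma> (\<iota> a)) (\<iota> a) B"
    using half_ball_swap[OF a] A B by auto
  have S: "word_tree (ep p) (join A a B)" using join_word_tree[OF m a A B] p by simp
  have S': "word_tree (ep (p \<cdot> [a])) (join B (\<iota> a) A)"
    using join_word_tree[OF m ia(1) B' A'] q by simp
  have far: "p \<cdot> [a] \<cdot> u = p \<cdot> (a # u)" for u using p a by (simp add: act_act)
  have near: "p \<cdot> [a] \<cdot> (\<iota> a # w) = p \<cdot> w" for w
    using act_cancel[OF p(1), of "[]" a w] p a by (simp add: act_act)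
  have "p \<cdot> [a] \<cdot> w \<in> act p ` join A a B" if "w \<in> join B (\<iota> a) A" for w
    using that far near by (auto simp: join_def)
  then show "verts (span (p \<cdot> [a]) (join B (\<iota> a) A)) \<subseteq> verts (span p (join A a B))" by auto
  show "edges (span (p \<cdot> [a]) (join B (\<iota> a) A)) \<subseteq> edges (span p (join A a B))"
  proof (clarify)
    fix x b assume "(x, b) \<in> edges (span (p \<cdot> [a]) (join B (\<iota> a) A))"
    then obtain w where w: "w \<in> join B (\<iota> a) A" "x = p \<cdot> [a] \<cdot> w"
      "b \<in> letters_at (join B (\<iota> a) A) w"
      using span_edge_iff[OF q(1) S'] by auto
    then consider "w \<in> B" | u where "u \<in> A" "w = \<iota> a # u" by (auto simp: join_def)
    then show "(x, b) \<in> edges (span p (join A a B))"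
    proof cases
      case 1
      then show ?thesis
        using w far span_edge_iff[OF p(1) S] join_letters(1)[OF m ia(1) B' A' 1]
          join_letters(2)[OF m a A B 1]
        by (intro iffD2[OF span_edge_iff[OF p(1) S]] bexI[of _ "a # w"])
          (auto simp: join_def split: if_splits)
    next
      case 2
      then show ?thesis
        using w near span_edge_iff[OF p(1) S] join_letters(2)[OF m ia(1) B' A' 2(1)] ia
          join_letters(1)[OF m a A B 2(1)]
        by (intro iffD2[OF span_edge_iff[OF p(1) S]] bexI[of _ u])
          (auto simp: join_def split: if_splits)
    qed
  qed
qed

lemma span_eqI:
  "verts (span p S) = verts (span q T) \<Longrightarrow> edges (span p S) = edges (span q T) \<Longrightarrow> span p S = span q T"
  by (rule graph.equality) (assumption | simp add: span_def Let_def)+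

lemma span_join_swap:
  assumes m: "m \<ge> 1" and A: "half_ball m (org \<Gamma> a) a A" and B: "half_ball m (ter \<Gamma> a) (\<iota> a) B"
    and e: "(p, a) \<in> edges X"
  shows "span (p \<cdot> [a]) (join B (\<iota> a) A) = span p (join A a B)"
proof -
  have a: "a \<in> edges \<Gamma>" and p: "p \<in> verts X" using e by (auto simp: edges_X)
  have "(p \<cdot> [a], \<iota> a) \<in> edges X" using graph_X e by (force simp: is_graph_def)
  from span_join_subset[OF m _ _ this] have
    "verts (span p (join A a B)) \<subseteq> verts (span (p \<cdot> [a]) (join B (\<iota> a) A))"
    "edges (span p (join A a B)) \<subseteq> edges (span (p \<cdot> [a]) (join B (\<iota> a) A))"
    using half_ball_swap[OF a] A B act_edge_back[OF p a] inv_inv[OF a] by auto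
  with span_join_subset[OF m A B e] show ?thesis by (intro span_eqI equalityI)
qed

text \<open>A leaf of either half has distance \<open>m\<close> from the end of \<open>a\<close> on its own side and \<open>m + 1\<close> from the
other end.\<close>

lemma join_central_edge:
  assumes m: "m \<ge> 1" and A: "half_ball m (org \<Gamma> a) a A" and B: "half_ball m (ter \<Gamma> a) (\<iota> a) B"
    and e: "(p, a) \<in> edges X"
  shows "central_edge X (Suc m) (span p (join A a B)) (p, a)"
    "span p (join A a B) \<in> \<B>' X (Suc m)"
proof -
  have p: "p \<in> verts X" "ep p = org \<Gamma> a" and a: "a \<in> edges \<Gamma>" using e by (auto simp: edges_X)
  note q = ter_edge_X[OF e]
  have S: "word_tree (ep p) (join A a B)" using join_word_tree[OF m a A B] p by simp
  have aS: "[a] \<in> join A a B" using join_two_letters[OF m a A B] by auto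
  have "(p \<cdot> [], a) \<in> edges (span p (join A a B))"
    using span_edge_act_iff[OF p(1) S word_treeD(2)[OF S]] aS by (simp add: letters_at_def)
  then have eJ: "(p, a) \<in> edges (span p (join A a B))" using p by simp
  have wA: "walk \<Gamma> (ep p) w (ep (p \<cdot> w))" "reduced \<iota> w" if "w \<in> A" for w
    using word_tree_walk(1)[OF p(1) _ that] word_treeD(4)[OF _ that] half_ballD(1)[OF A] p by auto
  have wB: "walk \<Gamma> (ep (p \<cdot> [a])) u (ep (p \<cdot> [a] \<cdot> u))" "reduced \<iota> u" if "u \<in> B" for u
    using word_tree_walk(1)[OF q(1) _ that] word_treeD(4)[OF _ that] half_ballD(1)[OF B] q by auto
  have "midpoint_dist X (p, a) v = real (Suc m) - 1/2"
    if v: "v \<in> terminal_verts (span p (join A a B))" for v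
  proof -
    obtain w where w: "w \<in> join A a B" "v = p \<cdot> w" using v by (auto simp: terminal_verts_def)
    then consider "w \<in> A" | u where "u \<in> B" "w = a # u" by (auto simp: join_def)
    then have "min (gdist X p v) (gdist X (p \<cdot> [a]) v) = m"
    proof cases
      case 1
      then have "length w = m" using join_terminal(1)[OF m a A B p] v w by simp
      moreover have "gdist X p v = length w" using gdist_act[OF p(1)] wA[OF 1] w by blast
      moreover have "gdist X (p \<cdot> [a]) v = length (\<iota> a # w)"
      proof -
        have "v = p \<cdot> [a] \<cdot> (\<iota> a # w)"
          using act_cancel[OF p(1), of "[]" a w] p a w by (simp add: act_act)
        moreover have "walk \<Gamma> (ep (p \<cdot> [a])) (\<iota> a # w) (ep (p \<cdot> w))"
          using wA[OF 1] q p a graph by (auto simp: is_graph_def)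
        moreover have "reduced \<iota> (\<iota> a # w)"
          using wA[OF 1] half_ballD(5)[OF A 1] inv_inv[OF a] by (auto simp: reduced_Cons)
        ultimately show ?thesis using gdist_act[OF q(1)] by blast
      qed
      ultimately show ?thesis by simp
    next
      case 2
      then have "length u = m" using join_terminal(2)[OF m a A B p] v w by simp
      moreover have v': "v = p \<cdot> [a] \<cdot> u" using w 2 a p by (simp add: act_act)
      moreover have "gdist X (p \<cdot> [a]) v = length u" using gdist_act[OF q(1)] wB[OF 2(1)] v' by blast
      moreover have "gdist X p v = length w"
        using gdist_act[OF p(1) word_tree_walk(1)[OF p(1) S w(1)] word_treeD(4)[OF S w(1)]] w by simp
      ultimately show ?thesis using 2 by simp
    qed
    then show ?thesis by (simp add: midpoint_dist_def)
  qed
  with eJ show c: "central_edge X (Suc m) (span p (join A a B)) (p, a)"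
    unfolding central_edge_def by blast
  show "span p (join A a B) \<in> \<B>' X (Suc m)"
    unfolding \<B>'_def using span_nondeg_finite_subtree[OF p(1) S aS] c by auto
qed

text \<open>The edge \<open>a\<close> is the only one joining the two halves, so without it the component of \<open>p\<close> consists of
the near half, whose terminal edges are the last edges of the words of length \<open>m\<close>.\<close>

lemma geom_part0_join:
  assumes m: "m \<ge> 1" and A: "half_ball m (org \<Gamma> a) a A" and B: "half_ball m (ter \<Gamma> a) (\<iota> a) B"
    and e: "(p, a) \<in> edges X"
  shows "geom_part0 (span p (join A a B)) (p, a) = (\<lambda>w. (p \<cdot> butlast w, last w)) ` {w \<in> A. length w = m}"
proof -
  let ?J = "span p (join A a B)"
  let ?D = "delete_edge ?J (p, a)"
  have p: "p \<in> verts X" "ep p = org \<Gamma> a" and a: "a \<in> edges \<Gamma>" using e by (auto simp: edges_X)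
  have S: "word_tree (ep p) (join A a B)" using join_word_tree[OF m a A B] p by simp
  have eJ: "(p, a) \<in> edges ?J"
    using join_central_edge(1)[OF m A B e] by (simp add: central_edge_def)
  have AJ: "A \<subseteq> join A a B" by (auto simp: join_def)
  have gD: "is_graph ?D" using is_graph_delete_edge[OF span_subgraph(1)[OF p(1) S] eJ] .
  have D [simp]: "org ?D = org X" "ter ?D = ter X" "einv ?D = einv X" "verts ?D = verts ?J"
    by (simp_all add: delete_edge_def)
  have A': "reduced \<iota> w" "set w \<subseteq> edges \<Gamma>" if "w \<in> A" for w
    using word_treeD(4,6)[OF half_ballD(1)[OF A] that] .
  \<comment> \<open>the deleted edge is the only one that leaves the near half\<close>
  have eD: "(p \<cdot> w, b) \<in> edges ?D \<longleftrightarrow> w @ [b] \<in> A \<or> w \<noteq> [] \<and> b = \<iota> (last w)" if w: "w \<in> A" for w b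
  proof -
    have "p \<cdot> w = p \<longleftrightarrow> w = []"
      using act_inj[OF p(1), of w "[]"] A' w p by auto
    moreover have "p \<cdot> w \<noteq> p \<cdot> [a]"
      using act_inj[OF p(1), of w "[a]"] A' w half_ballD(4)[OF A, of "[]"] by (auto simp: reduced_Cons)
    moreover have "[a] \<notin> A" using half_ballD(4)[OF A] .
    moreover have "(p \<cdot> w, b) \<in> edges ?J \<longleftrightarrow> b \<in> letters_at (join A a B) w"
      using span_edge_act_iff[OF p(1) S] AJ w by auto
    ultimately show ?thesis
      using join_letters(1)[OF m a A B w] by (auto simp: delete_edge_def)
  qed
  have to: "\<exists>es. walk ?D p es (p \<cdot> w)" if "w \<in> A" for w
    using that
  proof (induction w rule: rev_induct)
    case Nil
    have "p \<in> verts ?J" using word_treeD(2)[OF S] act_Nil[OF p(1)] by force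
    then show ?case using p by (intro exI[of _ "[]"]) (simp del: span_simps)
  next
    case (snoc b w)
    have w: "w \<in> A" using half_ballD(7)[OF A snoc.prems] .
    then obtain es where "walk ?D p es (p \<cdot> w)" using snoc.IH by blast
    moreover have "(p \<cdot> w, b) \<in> edges ?D" using eD[OF w] snoc.prems by blast
    moreover have "p \<cdot> w \<cdot> [b] = p \<cdot> (w @ [b])" using act_act p A' w by simp
    ultimately have "walk ?D p (es @ [(p \<cdot> w, b)]) (p \<cdot> (w @ [b]))"
      by (simp add: walk_snoc gD)
    then show ?case by blast
  qed
  have terback: "p \<cdot> w \<cdot> [\<iota> (last w)] = p \<cdot> butlast w" if w: "w \<in> A" "w \<noteq> []" for w
  proof -
    have "w = butlast w @ [last w]" using w by simp
    moreover have "last w \<in> edges \<Gamma>" "set (butlast w) \<subseteq> edges \<Gamma>"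
      using A'(2)[OF w(1)] w by (auto dest: in_set_butlastD)
    ultimately show ?thesis
      using act_cancel[OF p(1), of "butlast w" "last w" "[]"] act_act[OF p(1) A'(2)[OF w(1)]]
      by (metis append.assoc append_Cons append_Nil append_Nil2)
  qed
  have "from": "\<exists>w\<in>A. q = p \<cdot> w" if "walk ?D p es q" for es q
    using that
  proof (induction es arbitrary: q rule: rev_induct)
    case Nil
    then show ?case using half_ballD(6)[OF A] p by (intro bexI[of _ "[]"]) auto
  next
    case (snoc e es)
    then have e: "walk ?D p es (org X e)" "e \<in> edges ?D" "ter X e = q" by (auto simp: walk_snoc gD)
    then obtain w where w: "w \<in> A" "org X e = p \<cdot> w" using snoc.IH by blast
    then obtain b where b: "e = (p \<cdot> w, b)" by (cases e) auto
    then consider "w @ [b] \<in> A" | "w \<noteq> []" "b = \<iota> (last w)" using eD[OF w(1)] e by auto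
    then show ?case
    proof cases
      case 1
      then show ?thesis using e b act_act[OF p(1) A'(2)[OF w(1)]] by auto
    next
      case 2
      then have "butlast w \<in> A" using half_ballD(7)[OF A, of "butlast w" "last w"] w by simp
      then show ?thesis using terback[OF w(1)] 2 e b by (intro bexI[of _ "butlast w"]) auto
    qed
  qed
  have part: "x \<in> geom_part0 ?J (p, a) \<longleftrightarrow>
      x \<in> edges ?D \<and> ter X x \<in> terminal_verts ?J \<and> (\<exists>w\<in>A. fst x = p \<cdot> w)" for x
  proof -
    have "(\<exists>es. walk ?D p es q) \<longleftrightarrow> (\<exists>w\<in>A. q = p \<cdot> w)" for q using to "from" by blast
    moreover have "org X x = fst x" by (cases x) simp
    ultimately show ?thesis
      unfolding geom_part0_def component_def terminal_edges_def
      by (auto simp: delete_edge_def)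
  qed
  show ?thesis
  proof (intro equalityI subsetI)
    fix x assume x: "x \<in> geom_part0 ?J (p, a)"
    then obtain w b where w: "w \<in> A" "x = (p \<cdot> w, b)" unfolding part by (cases x) auto
    consider "w @ [b] \<in> A" | "w \<noteq> []" "b = \<iota> (last w)" using eD[OF w(1)] x w unfolding part by auto
    then show "x \<in> (\<lambda>w. (p \<cdot> butlast w, last w)) ` {w \<in> A. length w = m}"
    proof cases
      case 1
      have "p \<cdot> (w @ [b]) \<in> terminal_verts ?J"
        using x w p A' by (simp add: part act_act)
      then have "length (w @ [b]) = m" using join_terminal(1)[OF m a A B p 1] by simp
      then show ?thesis using 1 w by (intro image_eqI[of _ _ "w @ [b]"]) auto
    next
      case 2
      have wbl: "butlast w \<in> A" using half_ballD(7)[OF A, of "butlast w" "last w"] w 2 by simp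
      have "p \<cdot> butlast w \<in> terminal_verts ?J" using x w terback[OF w(1)] 2 by (simp add: part)
      then have "length (butlast w) = m" using join_terminal(1)[OF m a A B p wbl] by simp
      then show ?thesis using half_ballD(2)[OF A w(1)] 2 m by (cases w) auto
    qed
  next
    fix x assume "x \<in> (\<lambda>w. (p \<cdot> butlast w, last w)) ` {w \<in> A. length w = m}"
    then obtain w where w: "w \<in> A" "length w = m" "x = (p \<cdot> butlast w, last w)" by blast
    then have wne: "w \<noteq> []" using m by auto
    then have wb: "butlast w @ [last w] \<in> A" using w by simp
    then have bl: "butlast w \<in> A" using half_ballD(7)[OF A] by blast
    have "ter X x = p \<cdot> w" using w wne act_act[OF p(1) A'(2)[OF bl]] by simp
    then show "x \<in> geom_part0 ?J (p, a)"
      using eD[OF bl] wb join_terminal(1)[OF m a A B p w(1)] w bl unfolding part by auto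
  qed
qed

section \<open>The balance condition in terms of words\<close>

definition allowed_letters :: "'v \<Rightarrow> 'e list \<Rightarrow> 'e set" where
  "allowed_letters v w = {b. reduced \<iota> (w @ [b]) \<and> (\<exists>u. walk \<Gamma> v (w @ [b]) u)}"

text \<open>The tree with halves \<open>A\<close> and \<open>B\<close> around \<open>a\<close>, prolonged by the letters \<open>u w\<close> at each leaf \<open>w\<close> of the
near half. These are the trees \<open>J \<union> U\<^sub>1 \<union> \<dots> \<union> U\<^sub>n\<close>, with the edges of each \<open>U\<^sub>i\<close> replaced by their
letters.\<close>

definition grow :: "nat \<Rightarrow> 'e list set \<Rightarrow> 'e \<Rightarrow> 'e list set \<Rightarrow> ('e list \<Rightarrow> 'e set) \<Rightarrow> 'e list set" where
  "grow m A a B u = join A a B \<union> {w @ [b] | w b. w \<in> A \<and> length w = m \<and> b \<in> u w}"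

lemma finite_allowed: "finite (allowed_letters v w)"
proof -
  have "allowed_letters v w \<subseteq> edges \<Gamma>" using walk_edges by (fastforce simp: allowed_letters_def)
  then show ?thesis using finite_edges finite_subset by blast
qed

text \<open>Nonempty sets of letters at all leaves of the near half raise their depth from \<open>m\<close> to \<open>m + 1\<close>,
which is already the depth of the leaves of the far half as seen from the origin of \<open>a\<close>. Both
halves of the enlarged tree along \<open>a\<close> are unchanged.\<close>

lemma grow_ball:
  assumes m: "m \<ge> 1" and a: "a \<in> edges \<Gamma>"
    and A: "half_ball m (org \<Gamma> a) a A" and B: "half_ball m (ter \<Gamma> a) (\<iota> a) B"
    and u: "\<And>w. w \<in> A \<Longrightarrow> length w = m \<Longrightarrow> u w \<noteq> {} \<and> u w \<subseteq> allowed_letters (org \<Gamma> a) w"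
  shows "ball_words (Suc m) (org \<Gamma> a) (grow m A a B u)" "[a] \<in> grow m A a B u"
    "near m a (grow m A a B u) = A" "far a (grow m A a B u) = B"
    "\<And>w b. w \<in> A \<Longrightarrow> length w = m \<Longrightarrow> w @ [b] \<in> grow m A a B u \<longleftrightarrow> b \<in> u w"
proof -
  let ?T = "grow m A a B u"
  let ?new = "{w @ [b] | w b. w \<in> A \<and> length w = m \<and> b \<in> u w}"
  note S = join_word_tree[OF m a A B]
  have new: "\<exists>w b. x = w @ [b] \<and> w \<in> A \<and> length w = m \<and> b \<in> u w" if "x \<in> ?new" for x
    using that by blast
  have newI: "w @ [b] \<in> ?new" if "w \<in> A" "length w = m" "b \<in> u w" for w b using that by blast
  have newhd: "x \<noteq> [] \<and> hd x \<noteq> a \<and> length x = Suc m" if "x \<in> ?new" for x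
    using new[OF that] half_ballD(5)[OF A] m by (force simp: hd_append)
  have "?new \<subseteq> (\<lambda>(w, b). w @ [b]) ` (SIGMA w : A. allowed_letters (org \<Gamma> a) w)" using u by fastforce
  then have finnew: "finite ?new"
    using finite_allowed word_treeD(1)[OF half_ballD(1)[OF A]] finite_surj
    by (meson finite_SigmaI)
  have T: "word_tree (org \<Gamma> a) ?T"
    unfolding word_tree_def
  proof (intro conjI allI impI ballI)
    show "finite ?T" "[] \<in> ?T"
      using finnew word_treeD(1,2)[OF S] unfolding grow_def by blast+
    show "w \<in> ?T" if "w @ [b] \<in> ?T" for w b
      using that word_treeD(3)[OF S] unfolding grow_def join_def by auto
    fix w assume w: "w \<in> ?T"
    show "reduced \<iota> w" "\<exists>v. walk \<Gamma> (org \<Gamma> a) w v"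
    proof -
      have "reduced \<iota> w \<and> (\<exists>v. walk \<Gamma> (org \<Gamma> a) w v)"
      proof (cases "w \<in> ?new")
        case True
        then show ?thesis using new[OF True] u unfolding allowed_letters_def by blast
      next
        case False
        then show ?thesis using w word_treeD(4,5)[OF S] unfolding grow_def by blast
      qed
      then show "reduced \<iota> w" "\<exists>v. walk \<Gamma> (org \<Gamma> a) w v" by auto
    qed
  qed
  have len: "length w \<le> Suc m" if w: "w \<in> ?T" for w
  proof -
    consider "w \<in> A" | v where "v \<in> B" "w = a # v" | "w \<in> ?new"
      using w unfolding grow_def join_def by blast
    then show ?thesis
      using newhd half_ballD(2)[OF A] half_ballD(2)[OF B] by cases (simp_all add: le_SucI)
  qed
  have ext: "\<exists>b. w @ [b] \<in> ?T" if w: "w \<in> ?T" "length w < Suc m" for w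
  proof -
    have "w \<notin> ?new" using newhd[of w] w(2) by auto
    then have "w \<in> join A a B" using w(1) unfolding grow_def by blast
    moreover have "length w = m \<or> length w < m" using w(2) by auto
    ultimately consider "w \<in> A" "length w = m" | "w \<in> A" "length w < m" | v where "v \<in> B" "w = a # v"
      unfolding join_def by blast
    then show ?thesis
    proof cases
      case 1
      then show ?thesis using u[of w] newI[of w] unfolding grow_def by blast
    next
      case 2
      then show ?thesis using join_extend(1)[OF m a A B] unfolding grow_def by blast
    next
      case 3
      then show ?thesis using join_extend(2)[OF m a A B, of v] w unfolding grow_def by auto
    qed
  qed
  obtain b where b: "b \<noteq> a" "[a] \<in> join A a B" "[b] \<in> join A a B"
    using join_two_letters[OF m a A B] by blast
  then show "[a] \<in> ?T" by (simp add: grow_def)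
  show "ball_words (Suc m) (org \<Gamma> a) ?T"
    unfolding ball_words_def using T len ext b by (auto simp: grow_def)
  have T_cases: "x \<in> ?T \<longleftrightarrow> x \<in> A \<or> (\<exists>v\<in>B. x = a # v) \<or> x \<in> ?new" for x
    unfolding grow_def join_def by blast
  show "near m a ?T = A"
  proof (intro equalityI subsetI)
    fix x assume "x \<in> near m a ?T"
    then have "x \<in> ?T" "length x \<le> m" "x \<noteq> [] \<longrightarrow> hd x \<noteq> a" by (auto simp: near_def)
    then show "x \<in> A" using T_cases[of x] newhd[of x] by auto
  qed (use half_ballD(2,5)[OF A] T_cases in \<open>auto simp: near_def\<close>)
  show "far a ?T = B"
  proof (intro equalityI subsetI)
    fix x assume "x \<in> far a ?T"
    then show "x \<in> B" using T_cases[of "a # x"] newhd[of "a # x"] half_ballD(4)[OF A] by (auto simp: far_def)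
  qed (use T_cases in \<open>auto simp: far_def\<close>)
  show "w @ [b] \<in> ?T \<longleftrightarrow> b \<in> u w" if w: "w \<in> A" "length w = m" for w b
  proof -
    have "w @ [b] \<notin> join A a B" using join_extend(1)[OF m a A B w(1)] w by blast
    then show ?thesis using w unfolding grow_def by auto
  qed
qed

text \<open>Conversely, every ball arises in this way from its two halves along \<open>a\<close>: a word of full length
\<open>m + 1\<close> that does not start with \<open>a\<close> is a leaf of the near half followed by one letter.\<close>

lemma ball_grow:
  assumes T: "ball_words (Suc m) v T" and a: "[a] \<in> T"
  shows "T = grow m (near m a T) a (far a T) (\<lambda>w. {b. w @ [b] \<in> T})" (is "T = ?G")
    and "w \<in> T \<Longrightarrow> {b. w @ [b] \<in> T} \<subseteq> allowed_letters v w"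
proof -
  have S: "word_tree v T" using T by (simp add: ball_words_def)
  have "x \<in> ?G" if x: "x \<in> T" for x
  proof (cases x)
    case Nil
    then show ?thesis using x by (simp add: grow_def join_def near_def)
  next
    case (Cons c y)
    have len: "length x \<le> Suc m" using T x by (auto simp: ball_words_def)
    consider "c = a" | "c \<noteq> a" "length x \<le> m" | "c \<noteq> a" "length x = Suc m" using len by linarith
    then show ?thesis
    proof cases
      case 3
      obtain w b where wb: "x = w @ [b]" using Cons by (metis list.distinct(1) rev_exhaust)
      then have "w \<in> near m a T"
        using 3 x Cons word_treeD(3)[OF S, of w b] by (cases w) (auto simp: near_def)
      then show ?thesis using x wb 3 by (auto simp: grow_def)
    qed (use x Cons in \<open>auto simp: grow_def join_def near_def far_def\<close>)
  qed
  then show "T = ?G" by (auto simp: grow_def join_def near_def far_def)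
  show "w \<in> T \<Longrightarrow> {b. w @ [b] \<in> T} \<subseteq> allowed_letters v w"
    using word_treeD(4,5)[OF S] by (auto simp: allowed_letters_def)
qed

lemma next_edges_X:
  assumes p: "p \<in> verts X" and w: "w \<noteq> []" "reduced \<iota> w" "walk \<Gamma> (ep p) w v"
  shows "ter X (p \<cdot> butlast w, last w) = p \<cdot> w"
    "next_edges X (p \<cdot> butlast w, last w) = Pair (p \<cdot> w) ` allowed_letters (ep p) w"
proof -
  have wE: "set w \<subseteq> edges \<Gamma>" using walk_edges[OF w(3)] .
  have bl: "set (butlast w) \<subseteq> edges \<Gamma>" using wE in_set_butlastD by fast
  show ter: "ter X (p \<cdot> butlast w, last w) = p \<cdot> w" using act_act[OF p bl] w by simp
  have q: "p \<cdot> w \<in> verts X" "ep (p \<cdot> w) = v"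
    using act_vert[OF p w(3)] endpoint_act[OF p w(3)] by auto
  have walk: "(\<exists>u. walk \<Gamma> (ep p) (w @ [b]) u) \<longleftrightarrow> b \<in> edges \<Gamma> \<and> org \<Gamma> b = v" for b
    using w(3) walk_unique by (auto simp: walk_snoc[OF graph] dest: walk_unique)
  have "einv X (p \<cdot> butlast w, last w) = (p \<cdot> w, \<iota> (last w))" using ter by simp
  then show "next_edges X (p \<cdot> butlast w, last w) = Pair (p \<cdot> w) ` allowed_letters (ep p) w"
    using ter walk q w(1,2)
    by (auto simp: next_edges_def edges_X allowed_letters_def reduced_append reduced_Cons)
qed

text \<open>The trees \<open>J \<union> U\<^sub>1 \<union> \<dots> \<union> U\<^sub>n\<close> are the balls centred at \<open>p\<close> whose halves along \<open>a\<close> are \<open>A\<close> and \<open>B\<close>,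
and the family \<open>U\<close> can be recovered from such a ball. So one side of the balance condition is a sum
over balls with prescribed halves.\<close>

lemma ext_sum_join:
  assumes m: "m \<ge> 1" and A: "half_ball m (org \<Gamma> a) a A" and B: "half_ball m (ter \<Gamma> a) (\<iota> a) B"
    and e: "(p, a) \<in> edges X"
  shows "ext_sum X \<theta> (span p (join A a B)) (geom_part0 (span p (join A a B)) (p, a)) =
    (\<Sum>T | ball_words (Suc m) (org \<Gamma> a) T \<and> [a] \<in> T \<and> near m a T = A \<and> far a T = B. \<theta> (span p T))"
    (is "ext_sum X \<theta> ?J ?G = sum _ ?R")
proof -
  have p: "p \<in> verts X" "ep p = org \<Gamma> a" and a: "a \<in> edges \<Gamma>" using e by (auto simp: edges_X)
  define L where "L = {w \<in> A. length w = m}"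
  define te where "te w = (p \<cdot> butlast w, last w)" for w
  have G: "?G = te ` L" unfolding L_def te_def using geom_part0_join[OF m A B e] .
  have L: "w \<noteq> []" "reduced \<iota> w" "\<exists>v. walk \<Gamma> (ep p) w v" "w \<in> A" "length w = m" if "w \<in> L" for w
    using that m word_treeD(4,5)[OF half_ballD(1)[OF A]] p by (auto simp: L_def)
  have te: "ter X (te w) = p \<cdot> w" "next_edges X (te w) = Pair (p \<cdot> w) ` allowed_letters (ep p) w"
    if "w \<in> L" for w
    using L[OF that] next_edges_X[OF p(1)] unfolding te_def by blast+
  have te_inj: "w = w'" if "w \<in> L" "w' \<in> L" "te w = te w'" for w w'
    using act_inj[OF p(1) L(2)[OF that(1)] L(2)[OF that(2)]] te(1)[OF that(1)] te(1)[OF that(2)] that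
    by simp
  \<comment> \<open>families \<open>U\<close> of edge sets correspond to balls: \<open>i\<close> adds the chosen letters, and \<open>j\<close> recovers the
    choice as the edges of the ball that follow each terminal edge\<close>
  define u where "u U w = {b. (p \<cdot> w, b) \<in> U (te w)}" for U :: "'e list \<times> 'e \<Rightarrow> ('e list \<times> 'e) set" and w
  define i where "i U = grow m A a B (u U)" for U
  define j where "j T = (\<lambda>x\<in>?G. next_edges X x \<inter> edges (span p T))" for T
  let ?PE = "\<Pi>\<^sub>E x\<in>?G. P_plus (next_edges X x)"
  have U: "U (te w) = Pair (p \<cdot> w) ` u U w" "u U w \<noteq> {}" "u U w \<subseteq> allowed_letters (org \<Gamma> a) w"
    if "U \<in> ?PE" "w \<in> L" for U w
  proof -
    have "U (te w) \<in> P_plus (next_edges X (te w))" using that unfolding G by blast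
    then show "U (te w) = Pair (p \<cdot> w) ` u U w" "u U w \<noteq> {}" "u U w \<subseteq> allowed_letters (org \<Gamma> a) w"
      using te(2)[OF that(2)] p unfolding P_plus_def u_def by auto
  qed
  have good: "u U w \<noteq> {} \<and> u U w \<subseteq> allowed_letters (org \<Gamma> a) w"
    if "U \<in> ?PE" "w \<in> A" "length w = m" for U w
    using U[OF that(1), of w] that by (simp add: L_def)
  have iR: "i U \<in> ?R" if "U \<in> ?PE" for U
    using grow_ball[OF m a A B, of "u U"] good[OF that] by (simp add: i_def)
  have iL: "{b. w @ [b] \<in> i U} = u U w" if "U \<in> ?PE" "w \<in> L" for U w
    using grow_ball(5)[OF m a A B, of "u U"] good[OF that(1)] L(4,5)[OF that(2)] by (simp add: i_def)
  have inT: "next_edges X (te w) \<inter> edges (span p T) = Pair (p \<cdot> w) ` {b. w @ [b] \<in> T}"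
    if T: "T \<in> ?R" and w: "w \<in> L" for T w
  proof -
    have S: "word_tree (ep p) T" and b: "ball_words (Suc m) (ep p) T"
      using T p by (auto simp: ball_words_def)
    have wT: "w \<in> T" using T L[OF w] by (auto simp: near_def)
    have "b \<in> letters_at T w \<longleftrightarrow> w @ [b] \<in> T" if "b \<in> allowed_letters (ep p) w" for b
      using that L[OF w] by (auto simp: letters_at_def allowed_letters_def reduced_append)
    moreover have "{b. w @ [b] \<in> T} \<subseteq> allowed_letters (ep p) w"
      using ball_grow(2)[OF b] T wT by blast
    ultimately show ?thesis
      using te(2)[OF w] span_edge_act_iff[OF p(1) S wT] by auto
  qed
  show ?thesis
    unfolding ext_sum_def
  proof (rule sum.reindex_bij_witness[where i = j and j = i])
    fix U assume PE: "U \<in> ?PE"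
    show "i U \<in> ?R" using iR[OF PE] .
    show "j (i U) = U"
    proof (rule ext)
      fix x
      show "j (i U) x = U x"
      proof (cases "x \<in> ?G")
        case True
        then obtain w where w: "w \<in> L" "x = te w" unfolding G by blast
        then show ?thesis
          using True inT[OF iR[OF PE] w(1)] iL[OF PE w(1)] U(1)[OF PE w(1)] w by (simp add: j_def)
      next
        case False
        then show ?thesis using PiE_arb[OF PE False] by (simp add: j_def)
      qed
    qed
    have W: "(\<Union>x\<in>?G. U x) = {(p \<cdot> w, b) | w b. w \<in> L \<and> b \<in> u U w}" (is "_ = ?W")
      unfolding G using U(1)[OF PE] by auto
    let ?D = "\<lambda>T. {(p \<cdot> w, b) | w b. w @ [b] \<in> T}"
    have iU: "i U = join A a B \<union> {w @ [b] | w b. w \<in> L \<and> b \<in> u U w}"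
      by (auto simp: i_def grow_def L_def)
    have DU: "?D (i U) = ?D (join A a B) \<union> ?W" unfolding iU by auto
    have edges: "edges (span p (i U)) = edges ?J \<union> ?W \<union> einv X ` ?W"
      by (simp only: edges_span DU image_Un Un_ac)
    let ?N = "{w @ [b] | w b. w \<in> L \<and> b \<in> u U w}"
    have ter_new: "ter X (p \<cdot> w, b) = p \<cdot> (w @ [b])" if "w \<in> L" for w b
      using act_act[OF p(1)] L(3)[OF that] walk_edges by fastforce
    have tW: "ter X ` ?W = act p ` ?N"
    proof (intro equalityI subsetI)
      fix x assume "x \<in> ter X ` ?W"
      then obtain w b where "w \<in> L" "b \<in> u U w" "x = ter X (p \<cdot> w, b)" by blast
      then show "x \<in> act p ` ?N" using ter_new by blast
    next
      fix x assume "x \<in> act p ` ?N"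
      then obtain w b where "w \<in> L" "b \<in> u U w" "x = p \<cdot> (w @ [b])" by blast
      moreover from this have "x = ter X (p \<cdot> w, b)" "(p \<cdot> w, b) \<in> ?W" using ter_new by auto
      ultimately show "x \<in> ter X ` ?W" by blast
    qed
    have "org X ` ?W \<subseteq> act p ` join A a B" using L(4) by (auto simp: join_def)
    then have verts: "verts (span p (i U)) = verts ?J \<union> org X ` ?W \<union> ter X ` ?W"
      unfolding span_simps iU image_Un tW by blast
    have "add_edges ?J (\<Union>x\<in>?G. U x) = span p (i U)"
      unfolding W
      by (rule graph.equality) (use verts edges in \<open>simp_all add: add_edges_def del: span_simps(4)\<close>)
    then show "\<theta> (span p (i U)) = \<theta> (add_edges ?J (\<Union>x\<in>?G. U x))" by simp
  next
    fix T assume T: "T \<in> ?R"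
    then have b: "ball_words (Suc m) (ep p) T" "[a] \<in> T" "near m a T = A" "far a T = B"
      using p by auto
    have LT: "w \<in> T" if "w \<in> L" for w using L[OF that] b by (auto simp: near_def)
    show jPE: "j T \<in> ?PE"
    proof (rule PiE_I)
      fix x assume x: "x \<in> ?G"
      then obtain w where w: "w \<in> L" "x = te w" unfolding G by blast
      have "{b. w @ [b] \<in> T} \<noteq> {}"
        using b(1) LT[OF w(1)] L[OF w(1)] by (auto simp: ball_words_def)
      then show "j T x \<in> P_plus (next_edges X x)"
        using x inT[OF T w(1)] w by (auto simp: j_def P_plus_def)
    qed (simp add: j_def)
    have "u (j T) w = {b. w @ [b] \<in> T}" if "w \<in> L" for w
      using inT[OF T that] that unfolding u_def j_def G by auto
    then have "i (j T) = grow m A a B (\<lambda>w. {b. w @ [b] \<in> T})"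
      by (auto simp: i_def grow_def L_def)
    then show "i (j T) = T" using ball_grow(1)[OF b(1,2)] b by simp
  qed
qed

text \<open>Both blocks of the geometric partition have the same form, up to the orientation of the central
edge.\<close>

lemma geom_part1_swap:
  assumes "is_graph J" "e \<in> edges J"
  shows "geom_part1 J e = geom_part0 J (einv J e)"
proof -
  have "delete_edge J (einv J e) = delete_edge J e" "org J (einv J e) = ter J e"
    using assms by (auto simp: delete_edge_def is_graph_def insert_commute)
  then show ?thesis by (simp add: geom_part0_def geom_part1_def)
qed

text \<open>The tree around \<open>a\<close> is also the tree around \<open>a\<^sup>-\<^sup>1\<close> with the halves exchanged, so both sides of the
balance condition are given by \<open>ext_sum_join\<close>.\<close>

lemma balance_halves:
  assumes m: "m \<ge> 1" and A: "half_ball m (org \<Gamma> a) a A" and B: "half_ball m (ter \<Gamma> a) (\<iota> a) B"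
    and e: "(p, a) \<in> edges X"
    and balanced: "\<forall>J\<in>\<B>' X (Suc m). \<forall>e. central_edge X (Suc m) J e \<longrightarrow>
           ext_sum X \<theta> J (geom_part0 J e) = ext_sum X \<theta> J (geom_part1 J e)"
  shows "(\<Sum>T | ball_words (Suc m) (org \<Gamma> a) T \<and> [a] \<in> T \<and> near m a T = A \<and> far a T = B. \<theta> (span p T)) =
    (\<Sum>T | ball_words (Suc m) (ter \<Gamma> a) T \<and> [\<iota> a] \<in> T \<and> near m (\<iota> a) T = B \<and> far (\<iota> a) T = A.
        \<theta> (span (p \<cdot> [a]) T))"
proof -
  have a: "a \<in> edges \<Gamma>" "ter \<Gamma> a = org \<Gamma> (\<iota> a)" and p: "p \<in> verts X" "ep p = org \<Gamma> a"
    using e graph by (auto simp: edges_X is_graph_def)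
  have e': "(p \<cdot> [a], \<iota> a) \<in> edges X" using graph_X e by (force simp: is_graph_def)
  have S: "word_tree (ep p) (join A a B)" using join_word_tree[OF m a(1) A B] p by simp
  note c = join_central_edge[OF m A B e]
  have "geom_part1 (span p (join A a B)) (p, a) = geom_part0 (span p (join A a B)) (p \<cdot> [a], \<iota> a)"
    using geom_part1_swap[OF span_subgraph(1)[OF p(1) S]] c(1) by (simp add: central_edge_def)
  moreover have "half_ball m (org \<Gamma> (\<iota> a)) (\<iota> a) B" "half_ball m (ter \<Gamma> (\<iota> a)) (\<iota> (\<iota> a)) A"
    using half_ball_swap[OF a(1)] A B by auto
  ultimately show ?thesis
    using balanced[rule_format, OF c(2) c(1)] ext_sum_join[OF m A B e, of \<theta>]
      ext_sum_join[OF m _ _ e', of B A \<theta>] span_join_swap[OF m A B e] a(2)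
    by simp
qed

end

section \<open>Words read in a folded graph\<close>

lemma morphism_walk:
  assumes "graph_morphism G H f" "walk G u es v"
  shows "walk H (fst f u) (map (snd f) es) (fst f v)"
  using assms(2)
proof (induction es arbitrary: u)
  case Nil
  then show ?case using assms(1) by (auto simp: graph_morphism_def)
next
  case (Cons e es)
  then show ?case using assms(1) by (auto simp: graph_morphism_def)
qed

lemma folded_edge_unique:
  assumes "is_graph \<Delta>" "folded \<Delta> \<tau>" "e \<in> edges \<Delta>" "e' \<in> edges \<Delta>" "org \<Delta> e = org \<Delta> e'"
    "snd \<tau> e = snd \<tau> e'"
  shows "e = e'"
proof -
  have "org \<Delta> e \<in> verts \<Delta>" using assms(1,3) by (auto simp: is_graph_def)
  then have "inj_on (snd \<tau>) (out_edges \<Delta> (org \<Delta> e))" using assms(2) by (auto simp: folded_def)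
  then show ?thesis using assms by (auto simp: out_edges_def dest: inj_onD)
qed

lemma folded_walk_unique:
  assumes "is_graph \<Delta>" "folded \<Delta> \<tau>" "walk \<Delta> x es y" "walk \<Delta> x fs z"
    "map (snd \<tau>) es = map (snd \<tau>) fs"
  shows "es = fs" "y = z"
proof -
  have "es = fs" using assms(3-5)
  proof (induction es arbitrary: fs x)
    case (Cons e es)
    then obtain f fs' where fs: "fs = f # fs'" by (cases fs) auto
    then have "e = f" using Cons.prems folded_edge_unique[OF assms(1,2)] by auto
    then show ?case using Cons fs by auto
  qed simp
  then show "es = fs" "y = z" using assms(3,4) walk_unique by auto
qed

context based_graph
begin

definition language :: "('w, 'f) graph \<Rightarrow> ('w \<Rightarrow> 'v) \<times> ('f \<Rightarrow> 'e) \<Rightarrow> 'w \<Rightarrow> 'e list set" where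
  "language \<Delta> \<tau> x = {w. reduced \<iota> w \<and> (\<exists>es y. walk \<Delta> x es y \<and> map (snd \<tau>) es = w)}"

lemma language_Nil: "x \<in> verts \<Delta> \<Longrightarrow> [] \<in> language \<Delta> \<tau> x"
  by (auto simp: language_def intro: exI[of _ x])

lemma language_Cons:
  "a # w \<in> language \<Delta> \<tau> x \<longleftrightarrow> (w \<noteq> [] \<longrightarrow> hd w \<noteq> \<iota> a) \<and>
     (\<exists>e\<in>edges \<Delta>. org \<Delta> e = x \<and> snd \<tau> e = a \<and> w \<in> language \<Delta> \<tau> (ter \<Delta> e))"
  (is "?L \<longleftrightarrow> ?R")
proof
  assume ?L
  then have "reduced \<iota> (a # w)" "\<exists>es y. walk \<Delta> x es y \<and> map (snd \<tau>) es = a # w"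
    by (simp_all only: language_def mem_Collect_eq)
  then obtain es y where es: "walk \<Delta> x es y" "map (snd \<tau>) es = a # w" "reduced \<iota> (a # w)"
    by metis
  then obtain e es' where "es = e # es'" by (cases es) auto
  then show ?R using es by (auto simp: language_def reduced_Cons)
next
  assume ?R
  then obtain e es y where e: "w \<noteq> [] \<longrightarrow> hd w \<noteq> \<iota> a" "e \<in> edges \<Delta>" "org \<Delta> e = x" "snd \<tau> e = a"
    "reduced \<iota> w" "walk \<Delta> (ter \<Delta> e) es y" "map (snd \<tau>) es = w"
    by (auto simp: language_def)
  then have "walk \<Delta> x (e # es) y" "map (snd \<tau>) (e # es) = a # w" by auto
  moreover have "reduced \<iota> (a # w)" using e by (simp add: reduced_Cons)
  ultimately show ?L unfolding language_def mem_Collect_eq by metis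
qed

text \<open>If every vertex \<open>x\<close> carries a set \<open>S x\<close> of words, and the sets at the two ends of each edge
  agree where they overlap, then the words of length at most \<open>r\<close> read from \<open>x\<close> are those of
  \<open>S x\<close>: following one edge trades the first letter for a shorter word at the next vertex.\<close>

lemma language_eq:
  assumes nil: "\<And>x. x \<in> verts \<Delta> \<Longrightarrow> [] \<in> S x"
    and start: "\<And>x a w. x \<in> verts \<Delta> \<Longrightarrow> a # w \<in> S x \<Longrightarrow>
      length w < r \<and> (\<exists>e\<in>edges \<Delta>. org \<Delta> e = x \<and> snd \<tau> e = a)"
    and step: "\<And>e w. e \<in> edges \<Delta> \<Longrightarrow> length w < r \<Longrightarrow> snd \<tau> e # w \<in> S (org \<Delta> e) \<longleftrightarrow>
      w \<in> S (ter \<Delta> e) \<and> (w \<noteq> [] \<longrightarrow> hd w \<noteq> \<iota> (snd \<tau> e))"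
    and "is_graph \<Delta>" and x: "x \<in> verts \<Delta>"
  shows "{w \<in> language \<Delta> \<tau> x. length w \<le> r} = S x"
proof -
  have "length w \<le> r \<Longrightarrow> w \<in> language \<Delta> \<tau> x \<longleftrightarrow> w \<in> S x" for w
    using x
  proof (induction w arbitrary: x)
    case Nil
    then show ?case by (simp add: language_Nil nil)
  next
    case (Cons a w)
    have ter: "ter \<Delta> e \<in> verts \<Delta>" if "e \<in> edges \<Delta>" for e
      using that \<open>is_graph \<Delta>\<close> by (auto simp: is_graph_def)
    have len: "length w < r" "length w \<le> r" using Cons.prems by auto
    have IH: "w \<in> language \<Delta> \<tau> (ter \<Delta> e) \<longleftrightarrow> w \<in> S (ter \<Delta> e)" if "e \<in> edges \<Delta>" for e
      using Cons.IH[OF len(2) ter[OF that]] .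
    show ?case
    proof
      assume "a # w \<in> language \<Delta> \<tau> x"
      then obtain e where e: "e \<in> edges \<Delta>" "org \<Delta> e = x" "snd \<tau> e = a"
        "w \<in> language \<Delta> \<tau> (ter \<Delta> e)" "w \<noteq> [] \<longrightarrow> hd w \<noteq> \<iota> a"
        unfolding language_Cons by blast
      then show "a # w \<in> S x" using IH[OF e(1)] step[OF e(1) len(1)] by simp
    next
      assume aw: "a # w \<in> S x"
      then obtain e where e: "e \<in> edges \<Delta>" "org \<Delta> e = x" "snd \<tau> e = a"
        using start[OF Cons.prems(2)] by blast
      then have "w \<in> S (ter \<Delta> e)" "w \<noteq> [] \<longrightarrow> hd w \<noteq> \<iota> a"
        using aw step[OF e(1) len(1)] by simp_all
      then show "a # w \<in> language \<Delta> \<tau> x" using IH[OF e(1)] e unfolding language_Cons by blast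
    qed
  qed
  moreover have "length w \<le> r" if "w \<in> S x" for w
    using start[OF x, of "hd w" "tl w"] that by (cases w) auto
  ultimately show ?thesis by blast
qed

section \<open>Occurrences of balls\<close>

context
  fixes \<Delta> :: "('w, 'f) graph" and \<tau> :: "('w \<Rightarrow> 'v) \<times> ('f \<Rightarrow> 'e)"
    and p :: "'e list" and T :: "'e list set" and r :: nat
  assumes morph: "graph_morphism \<Delta> \<Gamma> \<tau>" and fold: "folded \<Delta> \<tau>"
    and p: "p \<in> verts X" and T: "ball_words r (ep p) T" and r: "r \<ge> 1"
begin

private lemma gD: "is_graph \<Delta>"
  using morph by (simp add: graph_morphism_def)

private lemma S: "word_tree (ep p) T"
  using T by (simp add: ball_words_def)

private lemma len: "w \<in> T \<Longrightarrow> length w \<le> r"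
  using T by (simp add: ball_words_def)

lemma Lk_span: "w \<in> T \<Longrightarrow> Lk (span p T) (covering \<Gamma> v0) (p \<cdot> w) = letters_at T w"
  unfolding Lk_def out_edges_span[OF p S] by (simp add: covering_def image_image)

lemma occurrence_walk:
  assumes "f \<in> occurrences (span p T) (covering \<Gamma> v0) \<Delta> \<tau>" "w \<in> T"
  shows "\<exists>es. walk (span p T) p es (p \<cdot> w) \<and> walk \<Delta> (fst f p) (map (snd f) es) (fst f (p \<cdot> w)) \<and>
    map (snd \<tau>) (map (snd f) es) = w"
proof -
  obtain es where es: "walk (span p T) p es (p \<cdot> w)" "map snd es = w"
    using span_walk[OF p S assms(2)] by blast
  have f: "graph_morphism (span p T) \<Delta> f" "\<forall>e\<in>edges (span p T). snd e = snd \<tau> (snd f e)"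
    using assms(1) by (auto simp: occurrences_def gamma_morphism_def covering_def)
  have "map (snd \<tau>) (map (snd f) es) = map snd es"
    using f(2) walk_edges[OF es(1)] by fastforce
  then show ?thesis using es morphism_walk[OF f(1) es(1)] by auto
qed

text \<open>The words of \<open>T\<close> can be read from the image of the centre because morphisms map walks to walks.
Conversely, a word read from there cannot leave \<open>T\<close> before length \<open>r\<close>: until then it runs through
images of inner vertices of the ball, and an occurrence preserves their links.\<close>

lemma occurrence_language:
  assumes f: "f \<in> occurrences (span p T) (covering \<Gamma> v0) \<Delta> \<tau>"
  shows "fst f p \<in> verts \<Delta>" "{w \<in> language \<Delta> \<tau> (fst f p). length w \<le> r} = T"
proof -
  have "\<exists>es. walk \<Delta> (fst f p) (map (snd f) es) (fst f (p \<cdot> []))"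
    using occurrence_walk[OF f word_treeD(2)[OF S]] by blast
  then show "fst f p \<in> verts \<Delta>" using walk_source[OF gD] by blast
  have "w \<in> T" if "w \<in> language \<Delta> \<tau> (fst f p)" "length w \<le> r" for w
    using that
  proof (induction w rule: rev_induct)
    case Nil
    then show ?case using word_treeD(2)[OF S] by simp
  next
    case (snoc b w)
    from snoc.prems(1) obtain es' y where es': "walk \<Delta> (fst f p) es' y"
      "map (snd \<tau>) es' = w @ [b]" "reduced \<iota> (w @ [b])"
      by (auto simp: language_def)
    then obtain es e where e: "es' = es @ [e]" "map (snd \<tau>) es = w" "snd \<tau> e = b"
      by (cases es' rule: rev_cases) auto
    then have walk: "walk \<Delta> (fst f p) es (org \<Delta> e)" and eD: "e \<in> edges \<Delta>"
      using es' by (auto simp: walk_snoc gD)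
    have "w \<in> language \<Delta> \<tau> (fst f p)"
      using walk e es'(3) by (auto simp: language_def reduced_append)
    then have w: "w \<in> T" using snoc by simp
    have "org \<Delta> e = fst f (p \<cdot> w)"
      using occurrence_walk[OF f w] walk e(2) folded_walk_unique(2)[OF gD fold] by metis
    then have "b \<in> Lk \<Delta> \<tau> (fst f (p \<cdot> w))"
      using e eD by (auto simp: Lk_def out_edges_def)
    moreover have "degree (span p T) (p \<cdot> w) \<ge> 2"
      using ball_words_terminal(2)[OF p T w] snoc.prems by simp
    then have "Lk (span p T) (covering \<Gamma> v0) (p \<cdot> w) = Lk \<Delta> \<tau> (fst f (p \<cdot> w))"
      using f w by (auto simp: occurrences_def)
    ultimately have "b \<in> letters_at T w" using Lk_span[OF w] by simp
    then show ?case using es'(3) by (auto simp: letters_at_def reduced_append split: if_splits)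
  qed
  moreover have "w \<in> language \<Delta> \<tau> (fst f p)" if "w \<in> T" for w
    using occurrence_walk[OF f that] word_treeD(4)[OF S that] unfolding language_def by blast
  ultimately show "{w \<in> language \<Delta> \<tau> (fst f p). length w \<le> r} = T" using len by blast
qed

lemma occurrence_unique:
  assumes f: "f \<in> occurrences (span p T) (covering \<Gamma> v0) \<Delta> \<tau>"
    and g: "g \<in> occurrences (span p T) (covering \<Gamma> v0) \<Delta> \<tau>" and eq: "fst f p = fst g p"
  shows "f = g"
proof -
  let ?K = "span p T"
  have mor: "graph_morphism ?K \<Delta> h" "\<And>e. e \<in> edges ?K \<Longrightarrow> snd \<tau> (snd h e) = snd e"
    if "h \<in> occurrences ?K (covering \<Gamma> v0) \<Delta> \<tau>" for h
    using that by (auto simp: occurrences_def gamma_morphism_def covering_def)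
  have vert: "fst f v = fst g v" if "v \<in> verts ?K" for v
  proof -
    obtain w where w: "w \<in> T" "v = p \<cdot> w" using \<open>v \<in> verts ?K\<close> by auto
    from occurrence_walk[OF f w(1)] occurrence_walk[OF g w(1)]
    show ?thesis using folded_walk_unique(2)[OF gD fold] eq w(2) by metis
  qed
  have edge: "snd f e = snd g e" if e: "e \<in> edges ?K" for e
  proof (rule folded_edge_unique[OF gD fold])
    have "org ?K e \<in> verts ?K" using e span_subgraph(1)[OF p S] by (simp add: is_graph_def)
    then show "org \<Delta> (snd f e) = org \<Delta> (snd g e)"
      using e vert mor(1)[OF f] mor(1)[OF g] by (simp add: graph_morphism_def)
    show "snd f e \<in> edges \<Delta>" "snd g e \<in> edges \<Delta>"
      using e mor(1)[OF f] mor(1)[OF g] by (auto simp: graph_morphism_def)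
    show "snd \<tau> (snd f e) = snd \<tau> (snd g e)" using e mor(2)[OF f] mor(2)[OF g] by simp
  qed
  have "fst f \<in> extensional (verts ?K)" "fst g \<in> extensional (verts ?K)"
    "snd f \<in> extensional (edges ?K)" "snd g \<in> extensional (edges ?K)"
    using f g by (auto simp: occurrences_def)
  then show ?thesis using vert edge by (intro prod_eqI extensionalityI)
qed

text \<open>Send \<open>p \<cdot> w\<close> to the end of the walk from \<open>x\<close> with label \<open>w\<close>, and an edge to the only edge with the
same label at the image of its origin.\<close>

lemma occurrence_exists:
  assumes x: "x \<in> verts \<Delta>" and L: "{w \<in> language \<Delta> \<tau> x. length w \<le> r} = T"
  shows "\<exists>f\<in>occurrences (span p T) (covering \<Gamma> v0) \<Delta> \<tau>. fst f p = x"
proof -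
  let ?K = "span p T"
  have "\<forall>w\<in>T. \<exists>y. \<exists>es. walk \<Delta> x es y \<and> map (snd \<tau>) es = w"
    using L by (auto simp: language_def)
  then obtain g where g: "\<And>w. w \<in> T \<Longrightarrow> \<exists>es. walk \<Delta> x es (g w) \<and> map (snd \<tau>) es = w"
    by metis
  have g_eq: "g w = y" if "w \<in> T" "walk \<Delta> x es y" "map (snd \<tau>) es = w" for w es y
    using g[OF that(1)] that folded_walk_unique(2)[OF gD fold] by metis
  \<comment> \<open>a vertex of the ball determines the word that leads to it from \<open>p\<close>\<close>
  define gv where "gv q = g (inv_into T (act p) q)" for q
  have inj: "inj_on (act p) T" using span_act_inj[OF p S] by (auto intro: inj_onI)
  have gv: "gv (p \<cdot> w) = g w" if "w \<in> T" for w
    using that inj by (simp add: gv_def)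
  have forward: "\<exists>e\<in>edges \<Delta>. org \<Delta> e = g w \<and> ter \<Delta> e = g (w @ [b]) \<and> snd \<tau> e = b"
    if wb: "w @ [b] \<in> T" for w b
  proof -
    obtain es' where es': "walk \<Delta> x es' (g (w @ [b]))" "map (snd \<tau>) es' = w @ [b]"
      using g[OF wb] by blast
    then obtain es e where e: "es' = es @ [e]" "map (snd \<tau>) es = w" "snd \<tau> e = b"
      by (cases es' rule: rev_cases) auto
    then have "walk \<Delta> x es (org \<Delta> e)" "e \<in> edges \<Delta>" "ter \<Delta> e = g (w @ [b])"
      using es' by (auto simp: walk_snoc gD)
    then show ?thesis using g_eq[OF word_treeD(3)[OF S wb] _ e(2)] e(3) by auto
  qed
  have step: "\<exists>e\<in>edges \<Delta>. org \<Delta> e = gv q \<and> ter \<Delta> e = gv (q \<cdot> [b]) \<and> snd \<tau> e = b"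
    if qb: "(q, b) \<in> edges ?K" for q b
  proof -
    obtain w where w: "w \<in> T" "q = p \<cdot> w" "b \<in> letters_at T w"
      using qb span_edge_iff[OF p S] by blast
    have wE: "set w \<subseteq> edges \<Gamma>" using word_treeD(6)[OF S w(1)] .
    show ?thesis
    proof (cases "w @ [b] \<in> T")
      case True
      then show ?thesis using forward[OF True] w act_act[OF p wE] gv by simp
    next
      case False
      then obtain w' c where w': "w = w' @ [c]" "b = \<iota> c"
        using w(3) by (cases w rule: rev_cases) (auto simp: letters_at_def)
      have w'T: "w' \<in> T" using word_treeD(3)[OF S] w w' by blast
      obtain e where e: "e \<in> edges \<Delta>" "org \<Delta> e = g w'" "ter \<Delta> e = g w" "snd \<tau> e = c"
        using forward w w' by blast
      have "q \<cdot> [b] = p \<cdot> w'"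
        using act_cancel[OF p, of w' c "[]"] act_act[OF p wE] w w' wE by simp
      moreover have "snd \<tau> (einv \<Delta> e) = b" using e w' morph by (auto simp: graph_morphism_def)
      ultimately show ?thesis
        using e gv w w'T gD by (intro bexI[of _ "einv \<Delta> e"]) (auto simp: is_graph_def)
    qed
  qed
  define h where "h qb = (SOME e. e \<in> edges \<Delta> \<and> org \<Delta> e = gv (fst qb) \<and>
    ter \<Delta> e = gv (fst qb \<cdot> [snd qb]) \<and> snd \<tau> e = snd qb)" for qb
  have h: "h (q, b) \<in> edges \<Delta> \<and> org \<Delta> (h (q, b)) = gv q \<and> ter \<Delta> (h (q, b)) = gv (q \<cdot> [b]) \<and>
      snd \<tau> (h (q, b)) = b" if "(q, b) \<in> edges ?K" for q b
    using someI_ex[OF step[OF that, unfolded Bex_def]] by (simp add: h_def)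
  define f where "f = (restrict gv (verts ?K), restrict h (edges ?K))"
  have gK: "is_graph ?K" using span_subgraph(1)[OF p S] .
  obtain a where a: "[a] \<in> T" using T by (auto simp: ball_words_def)
  have g_Nil: "g [] = x" using g_eq[OF word_treeD(2)[OF S], of "[]"] x by simp
  have px: "ep p = fst \<tau> x"
  proof -
    obtain e where e: "e \<in> edges \<Delta>" "org \<Delta> e = x" "snd \<tau> e = a"
      using forward[of "[]" a] a g_Nil by auto
    then have "org \<Gamma> a = fst \<tau> x" using morph by (auto simp: graph_morphism_def)
    then show ?thesis using word_treeD(5)[OF S a] by auto
  qed
  have vert: "gv q \<in> verts \<Delta>" "ep q = fst \<tau> (gv q)" if q: "q \<in> verts ?K" for q
  proof -
    obtain w where w: "w \<in> T" "q = p \<cdot> w" using q by auto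
    obtain es where es: "walk \<Delta> x es (g w)" "map (snd \<tau>) es = w" using g[OF w(1)] by blast
    show "gv q \<in> verts \<Delta>" using walk_target[OF es(1)] gv w by simp
    have "walk \<Gamma> (ep p) w (fst \<tau> (g w))" using morphism_walk[OF morph es(1)] es(2) px by simp
    then show "ep q = fst \<tau> (gv q)"
      using word_tree_walk(1)[OF p S w(1)] walk_unique gv w by fastforce
  qed
  have h_inv: "einv \<Delta> (h e) = h (einv X e)" if e: "e \<in> edges ?K" for e
  proof -
    obtain q b where qb: "e = (q, b)" by (cases e)
    then have e': "(q \<cdot> [b], \<iota> b) \<in> edges ?K" using e gK by (force simp: is_graph_def)
    note hq = h[of q b] and hq' = h[OF e']
    have "einv \<Delta> (h (q, b)) = h (q \<cdot> [b], \<iota> b)"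
    proof (rule folded_edge_unique[OF gD fold])
      show "einv \<Delta> (h (q, b)) \<in> edges \<Delta>" using hq e qb gD by (auto simp: is_graph_def)
      show "h (q \<cdot> [b], \<iota> b) \<in> edges \<Delta>" using hq' by simp
      show "org \<Delta> (einv \<Delta> (h (q, b))) = org \<Delta> (h (q \<cdot> [b], \<iota> b))"
        using hq hq' e qb gD by (auto simp: is_graph_def)
      show "snd \<tau> (einv \<Delta> (h (q, b))) = snd \<tau> (h (q \<cdot> [b], \<iota> b))"
        using hq hq' e qb morph by (auto simp: graph_morphism_def)
    qed
    then show ?thesis using qb by simp
  qed
  have ends: "org X e \<in> verts ?K \<and> ter X e \<in> verts ?K \<and> einv X e \<in> edges ?K"
    if "e \<in> edges ?K" for e
    using that gK by (simp add: is_graph_def)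
  have "graph_morphism ?K \<Delta> f"
    unfolding graph_morphism_def
  proof (intro conjI ballI gK gD)
    show "fst f ` verts ?K \<subseteq> verts \<Delta>" using vert(1) by (auto simp: f_def)
    show "snd f ` edges ?K \<subseteq> edges \<Delta>" using h by (auto simp: f_def)
    fix e assume e: "e \<in> edges ?K"
    obtain q b where qb: "e = (q, b)" by (cases e)
    show "org \<Delta> (snd f e) = fst f (org ?K e)" "ter \<Delta> (snd f e) = fst f (ter ?K e)"
      using h[of q b] e qb ends[OF e] by (simp_all add: f_def del: span_simps(4))
    show "einv \<Delta> (snd f e) = snd f (einv ?K e)"
      using h_inv[OF e] ends[OF e] e by (simp add: f_def)
  qed
  moreover have "snd e = snd \<tau> (snd f e)" if "e \<in> edges ?K" for e
    using h[of "fst e" "snd e"] that by (simp add: f_def)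
  moreover have "ep v = fst \<tau> (fst f v)" if "v \<in> verts ?K" for v
    using vert(2)[OF that] that by (simp add: f_def)
  moreover have "Lk ?K (covering \<Gamma> v0) v = Lk \<Delta> \<tau> (fst f v)"
    if v: "v \<in> verts ?K" "degree ?K v \<ge> 2" for v
  proof -
    obtain w where w: "w \<in> T" "v = p \<cdot> w" using v by auto
    have short: "length w < r" using ball_words_terminal(2)[OF p T w(1)] v w r by auto
    have fv: "fst f v = g w" using v w gv by (simp add: f_def)
    have "b \<in> letters_at T w \<longleftrightarrow> (\<exists>e\<in>edges \<Delta>. org \<Delta> e = g w \<and> snd \<tau> e = b)" for b
    proof
      assume "b \<in> letters_at T w"
      then show "\<exists>e\<in>edges \<Delta>. org \<Delta> e = g w \<and> snd \<tau> e = b"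
        using step[of v b] span_edge_act_iff[OF p S w(1)] w gv by auto
    next
      assume "\<exists>e\<in>edges \<Delta>. org \<Delta> e = g w \<and> snd \<tau> e = b"
      then obtain e where e: "e \<in> edges \<Delta>" "org \<Delta> e = g w" "snd \<tau> e = b" by blast
      show "b \<in> letters_at T w"
      proof (cases "w \<noteq> [] \<and> b = \<iota> (last w)")
        case False
        obtain es where "walk \<Delta> x es (g w)" "map (snd \<tau>) es = w" using g[OF w(1)] by blast
        then have "walk \<Delta> x (es @ [e]) (ter \<Delta> e)" "map (snd \<tau>) (es @ [e]) = w @ [b]"
          using e by (auto simp: walk_snoc gD)
        moreover have "reduced \<iota> (w @ [b])"
          using False word_treeD(4)[OF S w(1)] by (auto simp: reduced_append reduced_Cons)
        ultimately have "w @ [b] \<in> language \<Delta> \<tau> x" unfolding language_def by blast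
        then have "w @ [b] \<in> T" using L short by auto
        then show ?thesis by (simp add: letters_at_def)
      qed (auto simp: letters_at_def)
    qed
    then show ?thesis
      using Lk_span[OF w(1)] w fv by (auto simp: Lk_def out_edges_def)
  qed
  ultimately have "f \<in> occurrences ?K (covering \<Gamma> v0) \<Delta> \<tau>"
    by (simp add: occurrences_def gamma_morphism_def covering_def f_def del: span_simps(4))
  moreover have "fst f p = x"
  proof -
    have "p \<cdot> [] \<in> verts ?K" using word_treeD(2)[OF S] by (simp del: act_Nil)
    then show ?thesis using gv[OF word_treeD(2)[OF S]] g_Nil p by (simp add: f_def del: span_simps(4))
  qed
  ultimately show ?thesis by blast
qed

text \<open>In a folded graph an occurrence of a ball is determined by the image of its centre.\<close>

lemma card_occurrences:
  "card (occurrences (span p T) (covering \<Gamma> v0) \<Delta> \<tau>) =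
   card {x \<in> verts \<Delta>. {w \<in> language \<Delta> \<tau> x. length w \<le> r} = T}"
proof (rule bij_betw_same_card[of "\<lambda>f. fst f p"])
  show "bij_betw (\<lambda>f. fst f p) (occurrences (span p T) (covering \<Gamma> v0) \<Delta> \<tau>)
    {x \<in> verts \<Delta>. {w \<in> language \<Delta> \<tau> x. length w \<le> r} = T}"
    unfolding bij_betw_def
  proof (intro conjI inj_onI equalityI subsetI)
    fix x assume "x \<in> {x \<in> verts \<Delta>. {w \<in> language \<Delta> \<tau> x. length w \<le> r} = T}"
    then show "x \<in> (\<lambda>f. fst f p) ` occurrences (span p T) (covering \<Gamma> v0) \<Delta> \<tau>"
      using occurrence_exists by blast
  next
    fix x assume "x \<in> (\<lambda>f. fst f p) ` occurrences (span p T) (covering \<Gamma> v0) \<Delta> \<tau>"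
    then obtain f where "f \<in> occurrences (span p T) (covering \<Gamma> v0) \<Delta> \<tau>" "x = fst f p" by blast
    then show "x \<in> {x \<in> verts \<Delta>. {w \<in> language \<Delta> \<tau> x. length w \<le> r} = T}"
      using occurrence_language by simp
  qed (rule occurrence_unique)
qed

end

end

section \<open>Gluing balls along their edges\<close>

text \<open>Members of a finite set can be paired so that partners have opposite keys, provided that opposite
keys are equally frequent. Since no key is its own opposite, this only takes a bijection between
two disjoint classes for every pair of opposite keys.\<close>

lemma matching_involution:
  fixes key :: "'x \<Rightarrow> 'k" and opp :: "'k \<Rightarrow> 'k"
  assumes fin: "finite E"
    and opp: "\<And>x. x \<in> E \<Longrightarrow> opp (opp (key x)) = key x" "\<And>x. x \<in> E \<Longrightarrow> opp (key x) \<noteq> key x"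
    and card: "\<And>x. x \<in> E \<Longrightarrow> card {y \<in> E. key y = opp (key x)} = card {y \<in> E. key y = key x}"
  shows "\<exists>\<epsilon>. \<forall>x\<in>E. \<epsilon> x \<in> E \<and> \<epsilon> (\<epsilon> x) = x \<and> key (\<epsilon> x) = opp (key x)"
proof -
  define C where "C k = {y \<in> E. key y = k}" for k
  have "\<exists>\<phi>. bij_betw \<phi> (C k) (C (opp k))" if "k \<in> key ` E" for k
    using that card fin by (auto simp: C_def intro!: finite_same_card_bij)
  then obtain \<Phi> where \<Phi>: "bij_betw (\<Phi> k) (C k) (C (opp k))" if "k \<in> key ` E" for k
    by metis
  have opp_key: "opp k \<in> key ` E" if k: "k \<in> key ` E" for k
  proof -
    have "C k \<noteq> {}" using k by (auto simp: C_def)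
    then have "C (opp k) \<noteq> {}" using \<Phi>[OF k] by (auto simp: bij_betw_def)
    then obtain x where "x \<in> E" "key x = opp k" by (auto simp: C_def)
    then show ?thesis by (metis imageI)
  qed
  have opp_opp: "opp (opp k) = k" "opp k \<noteq> k" if "k \<in> key ` E" for k
    using that opp by auto
  \<comment> \<open>one class of each pair of opposite classes is mapped by the chosen bijection, the other one
    by its inverse\<close>
  define P where "P k \<longleftrightarrow> (SOME j. j \<in> {k, opp k}) = k" for k
  have P: "P (opp k) \<longleftrightarrow> \<not> P k" if k: "k \<in> key ` E" for k
  proof -
    have "{opp k, opp (opp k)} = {k, opp k}" using opp_opp[OF k] by auto
    moreover have "(SOME j. j \<in> {k, opp k}) \<in> {k, opp k}" by (rule someI[of _ k]) simp
    ultimately show ?thesis using opp_opp[OF k] unfolding P_def by auto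
  qed
  define \<epsilon> where "\<epsilon> x = (if P (key x) then \<Phi> (key x) x
    else inv_into (C (opp (key x))) (\<Phi> (opp (key x))) x)" for x
  have pos: "\<epsilon> x = \<Phi> (key x) x" if "P (key x)" for x
    using that by (simp add: \<epsilon>_def)
  have neg: "\<epsilon> x = inv_into (C (opp (key x))) (\<Phi> (opp (key x))) x" if "\<not> P (key x)" for x
    using that by (simp add: \<epsilon>_def)
  have "\<epsilon> x \<in> E \<and> \<epsilon> (\<epsilon> x) = x \<and> key (\<epsilon> x) = opp (key x)" if x: "x \<in> E" for x
  proof -
    have k: "key x \<in> key ` E" "x \<in> C (key x)" using x by (auto simp: C_def)
    note o = opp_opp[OF k(1)]
    show ?thesis
    proof (cases "P (key x)")
      case True
      have \<epsilon>: "\<epsilon> x = \<Phi> (key x) x" using pos[OF True] .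
      then have "\<epsilon> x \<in> C (opp (key x))" using \<Phi>[OF k(1)] k(2) by (auto simp: bij_betw_def)
      then have y: "\<epsilon> x \<in> E" "key (\<epsilon> x) = opp (key x)" by (auto simp: C_def)
      then have "\<epsilon> (\<epsilon> x) = inv_into (C (key x)) (\<Phi> (key x)) (\<Phi> (key x) x)"
        using neg[of "\<epsilon> x"] True P[OF k(1)] o(1) \<epsilon> by simp
      also have "\<dots> = x" using \<Phi>[OF k(1)] k(2) by (auto simp: bij_betw_def)
      finally show ?thesis using y by simp
    next
      case False
      let ?\<phi> = "\<Phi> (opp (key x))" and ?C = "C (opp (key x))"
      have \<epsilon>: "\<epsilon> x = inv_into ?C ?\<phi> x" using neg[OF False] .
      have bij: "bij_betw ?\<phi> ?C (C (key x))" using \<Phi>[OF opp_key[OF k(1)]] o(1) by simp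
      then have "\<epsilon> x \<in> ?C" using k(2) \<epsilon> by (auto simp: bij_betw_def inv_into_into)
      then have y: "\<epsilon> x \<in> E" "key (\<epsilon> x) = opp (key x)" by (auto simp: C_def)
      then have "\<epsilon> (\<epsilon> x) = ?\<phi> (\<epsilon> x)" using pos[of "\<epsilon> x"] False P[OF k(1)] by simp
      also have "\<dots> = x" unfolding \<epsilon> using bij k(2) by (auto simp: bij_betw_def f_inv_into_f)
      finally show ?thesis using y by simp
    qed
  qed
  then show ?thesis by blast
qed

lemma list_with_multiplicities:
  assumes "finite \<T>"
  shows "\<exists>xs. set xs \<subseteq> \<T> \<and> (\<forall>T\<in>\<T>. card {i. i < length xs \<and> xs ! i = T} = f T)"
proof -
  have "\<exists>xs. set xs \<subseteq> \<T> \<and> (\<forall>T\<in>\<T>. length (filter (\<lambda>y. y = T) xs) = f T)"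
    using assms
  proof (induction \<T>)
    case (insert S \<T>)
    then obtain xs where xs: "set xs \<subseteq> \<T>" "\<forall>T\<in>\<T>. length (filter (\<lambda>y. y = T) xs) = f T" by blast
    have "filter (\<lambda>y. y = S) xs = []" using xs(1) insert.hyps by (auto simp: filter_empty_conv)
    then show ?case
      using xs insert.hyps by (intro exI[of _ "replicate (f S) S @ xs"]) (auto simp: filter_replicate)
  qed simp
  then show ?thesis by (simp add: length_filter_conv_card)
qed

context finite_based_graph
begin

definition balls :: "nat \<Rightarrow> 'e list set set" where
  "balls r = {T. \<exists>p\<in>verts X. ball_words r (ep p) T}"

lemma finite_balls: "finite (balls r)"
proof (rule finite_subset)
  show "balls r \<subseteq> Pow {w. set w \<subseteq> edges \<Gamma> \<and> length w \<le> r}"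
    using word_treeD(6) by (fastforce simp: balls_def ball_words_def)
  show "finite (Pow {w. set w \<subseteq> edges \<Gamma> \<and> length w \<le> r})"
    using finite_lists_length_le[OF finite_edges] by simp
qed

lemma ball_words_base: "ball_words r v T \<Longrightarrow> [a] \<in> T \<Longrightarrow> v = org \<Gamma> a \<and> a \<in> edges \<Gamma>"
  using word_treeD(5)[of v T "[a]"] by (auto simp: ball_words_def)

text \<open>The graph is glued from one vertex for each unit of weight of each type of ball, and condition (1)
is used in the form that the weight of \<open>span p T\<close> depends only on \<open>T\<close> and on the endpoint of \<open>p\<close>.\<close>

lemma realization:
  assumes m: "m \<ge> 1"
    and invariant: "\<And>p q T. p \<in> verts X \<Longrightarrow> q \<in> verts X \<Longrightarrow> ep p = ep q \<Longrightarrow>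
      ball_words (Suc m) (ep p) T \<Longrightarrow> \<theta> (span p T) = \<theta> (span q T)"
    and balanced: "\<forall>J\<in>\<B>' X (Suc m). \<forall>e. central_edge X (Suc m) J e \<longrightarrow>
           ext_sum X \<theta> J (geom_part0 J e) = ext_sum X \<theta> J (geom_part1 J e)"
    and nonzero: "K \<in> \<B> X (Suc m)" "\<theta> K > 0"
  shows "\<exists>(\<Delta> :: (nat, nat) graph) \<tau>. cyclically_reduced \<Gamma> \<Delta> \<tau> \<and>
           (\<forall>K\<in>\<B> X (Suc m). \<theta> K = card (occurrences K (covering \<Gamma> v0) \<Delta> \<tau>))"
proof -
  let ?r = "Suc m"
  define base where "base T = (SOME p. p \<in> verts X \<and> ball_words ?r (ep p) T)" for T
  define weight where "weight T = \<theta> (span (base T) T)" for T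
  have base: "base T \<in> verts X" "ball_words ?r (ep (base T)) T" if "T \<in> balls ?r" for T
    using someI_ex[of "\<lambda>p. p \<in> verts X \<and> ball_words ?r (ep p) T"] that
    unfolding base_def balls_def by auto
  have weight: "weight T = \<theta> (span p T)" if pT: "p \<in> verts X" "ball_words ?r (ep p) T" for p T
  proof -
    have T: "T \<in> balls ?r" using pT by (auto simp: balls_def)
    obtain a where "[a] \<in> T" using pT by (auto simp: ball_words_def)
    then have "ep p = ep (base T)" using ball_words_base pT(2) base(2)[OF T] by metis
    then show ?thesis using invariant pT base[OF T] unfolding weight_def by metis
  qed
  \<comment> \<open>the vertices are the positions in a list containing each type \<open>T\<close> as often as its weight says\<close>
  obtain xs where xs: "set xs \<subseteq> balls ?r"
    "\<And>T. T \<in> balls ?r \<Longrightarrow> card {i. i < length xs \<and> xs ! i = T} = weight T"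
    using list_with_multiplicities[OF finite_balls] by metis
  define M where "M = length xs"
  define ty where "ty i = xs ! i" for i
  have ty: "ty i \<in> balls ?r" if "i < M" for i
    using that xs(1) by (auto simp: ty_def M_def)
  have card_ty: "card {i. i < M \<and> ty i = T} = weight T" if "T \<in> balls ?r" for T
    using xs(2)[OF that] by (simp add: M_def ty_def)
  have ball: "ball_words ?r (ep (base (ty i))) (ty i)" if "i < M" for i
    using base(2)[OF ty[OF that]] .
  have tree: "word_tree (ep (base (ty i))) (ty i)" if "i < M" for i
    using ball[OF that] by (simp add: ball_words_def)
  \<comment> \<open>the pair \<open>(i, a)\<close> is the edge with label \<open>a\<close> starting at the vertex \<open>i\<close>\<close>
  define E where "E = {(i, a). i < M \<and> [a] \<in> ty i}"
  define key where "key = (\<lambda>(i, a). (a, near m a (ty i), far a (ty i)))"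
  define opp where "opp = (\<lambda>(a, A :: 'e list set, B :: 'e list set). (\<iota> a, B, A))"
  have E: "a \<in> edges \<Gamma>" "org \<Gamma> a = ep (base (ty i))" if "(i, a) \<in> E" for i a
    using that ball_words_base[OF ball] by (auto simp: E_def)
  have inv: "\<iota> a \<in> edges \<Gamma> \<and> \<iota> a \<noteq> a \<and> \<iota> (\<iota> a) = a \<and> org \<Gamma> (\<iota> a) = ter \<Gamma> a" if "a \<in> edges \<Gamma>" for a
    using that graph by (simp add: is_graph_def)
  have finE: "finite E"
  proof (rule finite_subset)
    show "E \<subseteq> {..<M} \<times> edges \<Gamma>" using E by (auto simp: E_def)
  qed (use finite_edges in simp)
  have card_key: "card {x \<in> E. key x = (a, A, B)} =
      (\<Sum>T | ball_words ?r (org \<Gamma> a) T \<and> [a] \<in> T \<and> near m a T = A \<and> far a T = B. \<theta> (span p T))"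
    if p: "(p, a) \<in> edges X" for p a A B
  proof -
    let ?R = "{T. ball_words ?r (org \<Gamma> a) T \<and> [a] \<in> T \<and> near m a T = A \<and> far a T = B}"
    have p': "p \<in> verts X" "ep p = org \<Gamma> a" using p by (auto simp: edges_X)
    then have R: "?R \<subseteq> balls ?r" unfolding balls_def by (metis (mono_tags, lifting) mem_Collect_eq subsetI)
    have "{x \<in> E. key x = (a, A, B)} = (\<lambda>i. (i, a)) ` (\<Union>T\<in>?R. {i. i < M \<and> ty i = T})"
    proof (intro equalityI subsetI)
      fix x assume "x \<in> {x \<in> E. key x = (a, A, B)}"
      then obtain i where i: "x = (i, a)" "(i, a) \<in> E" "near m a (ty i) = A" "far a (ty i) = B"
        by (cases x) (auto simp: key_def)
      then have "i < M" "[a] \<in> ty i" "ball_words ?r (org \<Gamma> a) (ty i)"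
        using E(2)[OF i(2)] ball by (auto simp: E_def)
      then show "x \<in> (\<lambda>i. (i, a)) ` (\<Union>T\<in>?R. {i. i < M \<and> ty i = T})" using i by blast
    qed (auto simp: E_def key_def)
    then have "card {x \<in> E. key x = (a, A, B)} = card (\<Union>T\<in>?R. {i. i < M \<and> ty i = T})"
      by (simp add: card_image inj_on_def)
    also have "\<dots> = (\<Sum>T\<in>?R. card {i. i < M \<and> ty i = T})"
      using R finite_balls finite_subset by (intro card_UN_disjoint) auto
    also have "\<dots> = (\<Sum>T\<in>?R. \<theta> (span p T))"
      using R card_ty weight[OF p'(1)] p'(2) by (intro sum.cong refl) auto
    finally show ?thesis .
  qed
  have "\<exists>\<epsilon>. \<forall>x\<in>E. \<epsilon> x \<in> E \<and> \<epsilon> (\<epsilon> x) = x \<and> key (\<epsilon> x) = opp (key x)"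
  proof (rule matching_involution[OF finE])
    fix x assume "x \<in> E"
    then obtain i a where x: "x = (i, a)" "(i, a) \<in> E" by (cases x) auto
    note a = inv[OF E(1)[OF x(2)]]
    show "opp (opp (key x)) = key x" "opp (key x) \<noteq> key x"
      using a by (auto simp: opp_def key_def x(1))
    let ?A = "near m a (ty i)" and ?B = "far a (ty i)"
    have i: "i < M" "[a] \<in> ty i" using x by (auto simp: E_def)
    note halves = ball_half_balls[OF ball[OF i(1)] i(2)]
    have e: "(base (ty i), a) \<in> edges X"
      using E[OF x(2)] base(1)[OF ty[OF i(1)]] by (simp add: edges_X)
    have e': "(base (ty i) \<cdot> [a], \<iota> a) \<in> edges X" using graph_X e by (force simp: is_graph_def)
    show "card {y \<in> E. key y = opp (key x)} = card {y \<in> E. key y = key x}"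
      using card_key[OF e, of ?A ?B] card_key[OF e', of ?B ?A] a
        balance_halves[OF m halves(3,4) e balanced]
      by (simp add: x(1) key_def opp_def)
  qed
  then obtain \<epsilon> where \<epsilon>: "\<And>x. x \<in> E \<Longrightarrow> \<epsilon> x \<in> E \<and> \<epsilon> (\<epsilon> x) = x \<and> key (\<epsilon> x) = opp (key x)"
    by blast
  have \<epsilon>': "fst (\<epsilon> (i, a)) < M" "snd (\<epsilon> (i, a)) = \<iota> a"
    "near m (\<iota> a) (ty (fst (\<epsilon> (i, a)))) = far a (ty i)" "(fst (\<epsilon> (i, a)), \<iota> a) \<in> E"
    if "(i, a) \<in> E" for i a
    using \<epsilon>[OF that] by (cases "\<epsilon> (i, a)"; auto simp: key_def opp_def E_def)+
  \<comment> \<open>numbering the pairs makes the edges natural numbers\<close>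
  obtain c :: "nat \<times> 'e \<Rightarrow> nat" where c: "inj_on c E"
    using finite_imp_inj_to_nat_seg[OF finE] by blast
  define d where "d = inv_into E c"
  have d: "d (c x) = x" if "x \<in> E" for x using c that by (simp add: d_def)
  define \<Delta> where "\<Delta> = \<lparr>verts = {..<M}, edges = c ` E, org = fst \<circ> d, ter = fst \<circ> \<epsilon> \<circ> d,
    einv = c \<circ> \<epsilon> \<circ> d\<rparr>"
  define \<tau> where "\<tau> = (\<lambda>i. ep (base (ty i)), snd \<circ> d)"
  have \<Delta>_simps: "verts \<Delta> = {..<M}" "edges \<Delta> = c ` E"
    "\<And>x. x \<in> E \<Longrightarrow> org \<Delta> (c x) = fst x" "\<And>x. x \<in> E \<Longrightarrow> ter \<Delta> (c x) = fst (\<epsilon> x)"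
    "\<And>x. x \<in> E \<Longrightarrow> einv \<Delta> (c x) = c (\<epsilon> x)" "\<And>x. x \<in> E \<Longrightarrow> snd \<tau> (c x) = snd x"
    "\<And>i. fst \<tau> i = ep (base (ty i))"
    using d by (simp_all add: \<Delta>_def \<tau>_def)
  have g\<Delta>: "is_graph \<Delta>"
    unfolding is_graph_def \<Delta>_simps(1,2)
  proof (intro ballI, elim imageE)
    fix e x assume ex: "e = c x" "x \<in> E"
    obtain i a where x: "x = (i, a)" by (cases x)
    have "\<epsilon> x \<noteq> x" using \<epsilon>'(2)[of i a] ex x inv[OF E(1)[of i a]] by auto
    then have "c (\<epsilon> x) \<noteq> c x" using \<epsilon>[OF ex(2)] ex c by (auto dest: inj_onD)
    then show "org \<Delta> e \<in> {..<M} \<and> ter \<Delta> e \<in> {..<M} \<and> einv \<Delta> e \<in> c ` E \<and> einv \<Delta> e \<noteq> e \<and>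
      einv \<Delta> (einv \<Delta> e) = e \<and> org \<Delta> (einv \<Delta> e) = ter \<Delta> e \<and> ter \<Delta> (einv \<Delta> e) = org \<Delta> e"
      using \<epsilon>[OF ex(2)] \<epsilon>'(1)[of i a] ex x by (auto simp: \<Delta>_simps E_def)
  qed
  have morph: "graph_morphism \<Delta> \<Gamma> \<tau>"
    unfolding graph_morphism_def
  proof (intro conjI g\<Delta> graph)
    show "fst \<tau> ` verts \<Delta> \<subseteq> verts \<Gamma>"
    proof clarify
      fix i assume "i \<in> verts \<Delta>"
      then have "base (ty i) \<in> verts X" using base(1) ty by (simp add: \<Delta>_simps)
      then show "fst \<tau> i \<in> verts \<Gamma>" using walk_target by (fastforce simp: \<Delta>_simps verts_X)
    qed
    show "snd \<tau> ` edges \<Delta> \<subseteq> edges \<Gamma>" using E by (auto simp: \<Delta>_simps)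
    show "\<forall>e\<in>edges \<Delta>. org \<Gamma> (snd \<tau> e) = fst \<tau> (org \<Delta> e) \<and> ter \<Gamma> (snd \<tau> e) = fst \<tau> (ter \<Delta> e) \<and>
      \<iota> (snd \<tau> e) = snd \<tau> (einv \<Delta> e)"
    proof
      fix e assume "e \<in> edges \<Delta>"
      then obtain i a where e: "e = c (i, a)" "(i, a) \<in> E" by (auto simp: \<Delta>_simps)
      have "ter \<Gamma> a = ep (base (ty (fst (\<epsilon> (i, a)))))"
        using E(2)[OF \<epsilon>'(4)[OF e(2)]] inv[OF E(1)[OF e(2)]] by simp
      then show "org \<Gamma> (snd \<tau> e) = fst \<tau> (org \<Delta> e) \<and> ter \<Gamma> (snd \<tau> e) = fst \<tau> (ter \<Delta> e) \<and>
        \<iota> (snd \<tau> e) = snd \<tau> (einv \<Delta> e)"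
        using E[OF e(2)] \<epsilon>[OF e(2)] \<epsilon>'[OF e(2)] e by (simp add: \<Delta>_simps)
    qed
  qed
  have fold: "folded \<Delta> \<tau>"
    unfolding folded_def by (auto intro!: inj_onI simp: out_edges_def \<Delta>_simps)
  have deg: "degree \<Delta> i \<ge> 2" if i: "i \<in> verts \<Delta>" for i
  proof -
    have iM: "i < M" using i by (simp add: \<Delta>_simps)
    then obtain a b where ab: "a \<noteq> b" "[a] \<in> ty i" "[b] \<in> ty i"
      using ball[OF iM] by (auto simp: ball_words_def)
    then have "(i, a) \<in> E" "(i, b) \<in> E" using iM by (auto simp: E_def)
    then have "c (i, a) \<in> out_edges \<Delta> i" "c (i, b) \<in> out_edges \<Delta> i" "c (i, a) \<noteq> c (i, b)"
      using ab(1) c by (auto simp: out_edges_def \<Delta>_simps dest: inj_onD)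
    moreover have "finite (out_edges \<Delta> i)" using finE by (simp add: out_edges_def \<Delta>_simps)
    ultimately show ?thesis unfolding degree_def using card_ge_2_iff by blast
  qed
  have lang: "{w \<in> language \<Delta> \<tau> i. length w \<le> ?r} = ty i" if i: "i \<in> verts \<Delta>" for i
  proof (rule language_eq[OF _ _ _ g\<Delta> i])
    fix j assume "j \<in> verts \<Delta>"
    then have j: "j < M" by (simp add: \<Delta>_simps)
    show "[] \<in> ty j" using word_treeD(2)[OF tree[OF j]] .
    fix a w assume aw: "a # w \<in> ty j"
    then have "[a] \<in> ty j" using word_tree_prefix[OF tree[OF j], of "[a]" w] by simp
    then have "(j, a) \<in> E" using j by (simp add: E_def)
    then have "c (j, a) \<in> edges \<Delta>" "org \<Delta> (c (j, a)) = j" "snd \<tau> (c (j, a)) = a"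
      by (auto simp: \<Delta>_simps)
    moreover have "length (a # w) \<le> ?r" using ball[OF j] aw unfolding ball_words_def by blast
    ultimately show "length w < ?r \<and> (\<exists>e\<in>edges \<Delta>. org \<Delta> e = j \<and> snd \<tau> e = a)" by auto
  next
    fix e and w :: "'e list" assume "e \<in> edges \<Delta>" and w: "length w < ?r"
    then obtain k a where e: "e = c (k, a)" "(k, a) \<in> E" by (auto simp: \<Delta>_simps)
    have "a # w \<in> ty k \<longleftrightarrow> w \<in> near m (\<iota> a) (ty (fst (\<epsilon> (k, a))))"
      unfolding \<epsilon>'(3)[OF e(2)] by (simp add: far_def)
    also have "\<dots> \<longleftrightarrow> w \<in> ty (fst (\<epsilon> (k, a))) \<and> (w \<noteq> [] \<longrightarrow> hd w \<noteq> \<iota> a)"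
      using w unfolding near_def by (simp add: less_Suc_eq_le)
    finally show "snd \<tau> e # w \<in> ty (org \<Delta> e) \<longleftrightarrow>
      w \<in> ty (ter \<Delta> e) \<and> (w \<noteq> [] \<longrightarrow> hd w \<noteq> \<iota> (snd \<tau> e))"
      unfolding e(1) \<Delta>_simps(3)[OF e(2)] \<Delta>_simps(4)[OF e(2)] \<Delta>_simps(6)[OF e(2)] fst_conv snd_conv .
  qed
  have count: "\<theta> K = card (occurrences K (covering \<Gamma> v0) \<Delta> \<tau>)" if K: "K \<in> \<B> X ?r" for K
  proof -
    obtain p T where p: "p \<in> verts X" "ball_words ?r (ep p) T" "K = span p T"
      using ball_span[OF K] by auto
    have "{x \<in> verts \<Delta>. {w \<in> language \<Delta> \<tau> x. length w \<le> ?r} = T} = {i. i < M \<and> ty i = T}"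
      using lang by (auto simp: \<Delta>_simps)
    moreover have "T \<in> balls ?r" using p by (auto simp: balls_def)
    ultimately show ?thesis
      using card_occurrences[OF morph fold p(1,2)] card_ty weight[OF p(1,2)] p(3) by simp
  qed
  have "M \<noteq> 0"
  proof
    assume "M = 0"
    obtain p T where p: "p \<in> verts X" "ball_words ?r (ep p) T" "K = span p T"
      using ball_span[OF nonzero(1)] by auto
    then have "T \<in> balls ?r" by (auto simp: balls_def)
    then show False using card_ty[of T] \<open>M = 0\<close> weight[OF p(1,2)] p(3) nonzero(2) by simp
  qed
  then have "cyclically_reduced \<Gamma> \<Delta> \<tau>"
    unfolding cyclically_reduced_def finite_graph_def
    using g\<Delta> finE morph fold deg by (auto simp: \<Delta>_simps(1,2))
  then show ?thesis using count by blast
qed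

end

theorem theorem1:
  fixes N r :: nat
    and \<Gamma> :: "('v, 'e) graph" and v0 :: 'v
    and \<alpha> :: "(nat \<times> bool) list \<Rightarrow> 'e list"
    and X :: "('e list, 'e list \<times> 'e) graph"
    and \<theta> :: "('e list, 'e list \<times> 'e) graph \<Rightarrow> nat"
  assumes "N \<ge> 2"
    and "marking N \<Gamma> v0 \<alpha>"
    and "X = univ_cover \<Gamma> v0"
    and "r \<ge> 2"
    and "\<forall>K\<in>\<B> X r. \<forall>g\<in>carrier (free_group N). \<theta> (translate \<Gamma> (\<alpha> g) K) = \<theta> K"
    and "\<forall>J\<in>\<B>' X r. \<forall>e. central_edge X r J e \<longrightarrow>
           ext_sum X \<theta> J (geom_part0 J e) = ext_sum X \<theta> J (geom_part1 J e)"
    and "\<exists>K\<in>\<B> X r. \<theta> K > 0"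
  shows "\<exists>(\<Delta> :: (nat, nat) graph) \<tau>. cyclically_reduced \<Gamma> \<Delta> \<tau> \<and>
           (\<forall>K\<in>\<B> X r. \<theta> K = card (occurrences K (covering \<Gamma> v0) \<Delta> \<tau>))"
proof -
  interpret finite_based_graph \<Gamma> v0
    using assms(2) by unfold_locales (auto simp: marking_def finite_graph_def)
  obtain m where m: "r = Suc m" "m \<ge> 1" using assms(4) by (cases r) auto
  obtain K where K: "K \<in> \<B> X r" "\<theta> K > 0" using assms(7) by blast
  have "\<theta> (span p T) = \<theta> (span q T)"
    if pq: "p \<in> verts X" "q \<in> verts X" "ep p = ep q" and T: "ball_words r (ep p) T" for p q T
  proof -
    have pq': "p \<in> verts (univ_cover \<Gamma> v0)" "q \<in> verts (univ_cover \<Gamma> v0)"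
      using pq assms(3) by auto
    have "word_tree (ep p) T" using T by (simp add: ball_words_def)
    note h = translate_span[OF pq' pq(3) this]
    \<comment> \<open>the marking is onto, so condition (1) covers all covering transformations\<close>
    have "\<alpha> ` carrier (free_group N) = carrier (pi1 \<Gamma> v0)"
      using assms(2) by (auto simp: marking_def iso_def bij_betw_def)
    then obtain g where g: "g \<in> carrier (free_group N)" "\<alpha> g = q \<cdot> inv_word (einv \<Gamma>) p"
      using h(1) by (metis imageE)
    have "\<theta> (span q T) = \<theta> (translate \<Gamma> (\<alpha> g) (span p T))" using h(2) g(2) by simp
    also have "\<dots> = \<theta> (span p T)" using assms(3,5) span_ball[OF pq'(1) T] g(1) by blast
    finally show ?thesis by simp
  qed
  then show ?thesis
    using realization[OF m(2), of \<theta> K] assms(3,6) K unfolding m(1) by blast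
qed

end
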